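(* Let $\mathbb{F}$ be a field, let $d\ge3$ be an integer, and let $\Phi=(A;\{E_i\}_{i=0}^d;A^*;\{E^*_i\}_{i=0}^d)$ be a recurrent CH system over $\mathbb{F}$ of diameter $d$. Then $\Phi$ is isomorphic to a member of one of the four families (I), (II), (III), (IV) of CH systems on $\mathbb{F}^{d+1}$ described in the context.
   Context: Let $V$ be a vector space over $\mathbb{F}$ of dimension $d+1$ with $d\ge3$. Rows and columns of $(d+1)\times(d+1)$ matrices are indexed by $0,\dots,d$. A matrix $M$ represents $B\in\mathrm{End}(V)$ with respect to a basis $\{v_i\}_{i=0}^d$ if $Bv_j=\sum_i M_{ij}v_i$ for all $j$. An element of $\mathrm{End}(V)$ is multiplicity-free if it is diagonalizable with all eigenspaces of dimension one. The primitive idempotent of a multiplicity-free $B$ for an eigenvalue $\theta$ is the $E\in\mathrm{End}(V)$ acting as the identity on the $\theta$-eigenspace and as $0$ on the other eigenspaces. CH system. A CH system on $V$ (over $\mathbb{F}$, of diameter $d$) is a sequence $\Phi=(A;\{E_i\}_{i=0}^d;A^*;\{E^*_i\}_{i=0}^d)$ in $\mathrm{End}(V)$ such that: (i) $A,A^*$ are multiplicity-free; (ii) $\{E_i\}_{i=0}^d$ is an ordering of the primitive idempotents of $A$; (iii) $\{E^*_i\}_{i=0}^d$ is an ordering of the primitive idempotents of $A^*$; (iv) $E_iA^*E_j=0$ if $1<i-j$ or $1<j-i<d$, and $E_iA^*E_j\neq0$ if $i-j=1$ or $j-i=d$; (v) $E^*_iAE^*_j=0$ if $1<i-j$ or $1<j-i<d$,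 and $E^*_iAE^*_j\neq0$ if $i-j=1$ or $j-i=d$ $(0\le i,j\le d)$. Isomorphism. CH systems $(A;\{E_i\};A^*;\{E^*_i\})$ on $V$ and $(B;\{F_i\};B^*;\{F^*_i\})$ on $V'$ are isomorphic if there is a vector space isomorphism $\sigma:V\to V'$ with $\sigma A\sigma^{-1}=B$, $\sigma A^*\sigma^{-1}=B^*$, $\sigma E_i\sigma^{-1}=F_i$ and $\sigma E^*_i\sigma^{-1}=F^*_i$ for all $i$. Bidiagonal form. Given scalars $\{\theta_i\}_{i=0}^d,\{\theta^*_i\}_{i=0}^d,\{\phi_i\}_{i=1}^d$ in $\mathbb{F}$, let $L$ be the lower bidiagonal matrix with $(i,i)$-entry $\theta_{d-i}$ and $(i,i-1)$-entry $1$, and $U$ the upper bidiagonal matrix with $(i,i)$-entry $\theta^*_i$ and $(i-1,i)$-entry $\phi_i$ (all other entries $0$). Parameters of a CH system. For a CH system $\Phi$, let $\theta_i$ (resp. $\theta^*_i$) be the eigenvalue of $A$ (resp. $A^*$) corresponding to $E_i$ (resp. $E^*_i$). It is known that there is a unique sequence $\{\phi_i\}_{i=1}^d$ of nonzero scalars (the $\Phi$-split sequence) for which some basis of $V$ has $A$ represented by $L$ and $A^*$ represented by $U$. Put $\vartheta_0=\vartheta_{d+1}=0$ and $\vartheta_i=\phi_i-(\theta^*_i-\theta^*_0)(\theta_{d-i+1}-\theta_0)$ for $1\le i\le d$. Recurrent. A sequence $\{\sigma_i\}_{i=0}^n$ in $\mathbb{F}$ is $\beta$-recurrent if $\sigma_{i-2}-(\beta+1)\sigma_{i-1}+(\beta+1)\sigma_i-\sigma_{i+1}=0$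 for $2\le i\le n-1$. $\Phi$ is recurrent if there is $\beta\in\mathbb{F}$ such that $\{\theta_i\}_{i=0}^d$, $\{\theta^*_i\}_{i=0}^d$, $\{\vartheta_i\}_{i=0}^{d+1}$ are all $\beta$-recurrent. The four families. Each member is the sequence $(L;\{E_i\}_{i=0}^d;U;\{E^*_i\}_{i=0}^d)$ on $\mathbb{F}^{d+1}$, where $L,U$ are the matrices above built from scalars $\theta_i,\theta^*_i,\phi_i\in\mathbb{F}$ of one of the following types, and $E_i$ (resp. $E^*_i$) is the primitive idempotent of $L$ for $\theta_i$ (resp. of $U$ for $\theta^*_i$). (Each such sequence is a CH system.) $\overline{\mathbb{F}}$ denotes the algebraic closure of $\mathbb{F}$. (I) There is $0\ne q\in\overline{\mathbb{F}}$ with $q+q^{-1}\in\mathbb{F}$, $q^i\ne1$ for $1\le i\le d$, $q^{d+1}=1$, and there are $a,b,c,a^*,b^*,c^*\in\overline{\mathbb{F}}$ with $c\ne bq^i$ and $c^*\ne b^*q^i$ for $1\le i\le 2d-1$, and distinct $y,z\in\overline{\mathbb{F}}$, such that $\theta_i=a+bq^i+cq^{-i}$, $\theta^*_i=a^*+b^*q^i+c^*q^{-i}$ $(0\le i\le d)$, and $\phi_i=(q^i-1)(y-zq^{-i})+(q^i-1)(q^{-i}-1)(b-cq^i)(b^*-c^*q^{-i})\neq0$ $(1\le i\le d)$. (II) $\mathrm{Char}(\mathbb{F})=d+1$, and there are $a,b,c,a^*,b^*,c^*\in\mathbb{F}$ with $2b\ne c(1-i)$ and $2b^*\ne c^*(1-i)$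 for $1\le i\le 2d-1$, and $y,z\in\mathbb{F}$ with $2y\neq z$, such that $\theta_i=a+bi+ci(i-1)/2$, $\theta^*_i=a^*+b^*i+c^*i(i-1)/2$ $(0\le i\le d)$, and $\phi_i=i\big(y+z(i-1)/2\big)-i^2\big(b+c(d-i)/2\big)\big(b^*+c^*(i-1)/2\big)\ne0$ $(1\le i\le d)$. (III) $d$ is odd, $d\ge5$, $\mathrm{Char}(\mathbb{F})=(d+1)/2$, and there are $a,b,c,a^*,b^*,c^*\in\mathbb{F}$ with $b,b^*,c,c^*$ all nonzero and $2b\ne -ic$, $2b^*\neq -ic^*$ for all odd $i$ with $1\le i\le 2d-1$, and $y,z\in\mathbb{F}$ with $z\ne0$, such that $\theta_i=a+b(-1)^i+ci(-1)^i$, $\theta^*_i=a^*+b^*(-1)^i+c^*i(-1)^i$ $(0\le i\le d)$, and $\phi_i=y\big((-1)^i-1\big)+zi(-1)^i+\big(b((-1)^i-1)-ci(-1)^i\big)\big(b^*((-1)^i-1)+c^*i(-1)^i\big)\ne0$ $(1\le i\le d)$. (IV) $d=3$, $\mathrm{Char}(\mathbb{F})=2$, and there are $a,b,c,a^*,b^*,c^*\in\mathbb{F}$ with $b,b^*,c,c^*$ all nonzero, $b\ne c$, $b^*\ne c^*$, and $y,z\in\mathbb{F}$ with $z\neq0$, such that $\theta_i=a+bi+c\binom{i}{2}$, $\theta^*_i=a^*+b^*i+c^*\binom{i}{2}$ $(0\le i\le3)$, and $\phi_i=yi+z\binom{i}{2}+\big(bi+c\binom{i+1}{2}\big)\big(b^*i+c^*\binom{i}{2}\big)\ne0$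 $(1\le i\le3)$, where $\binom{n}{2}$ is interpreted as $0\in\mathbb{F}$ if $n\equiv0,1\pmod 4$ and as $1\in\mathbb{F}$ if $n\equiv2,3\pmod4$. *)

theory Defs
  imports "Jordan_Normal_Form.VS_Connect" "HOL-Algebra.Algebraic_Closure_Type"
begin

text \<open>
  The field is a type \<open>'a::field\<close>; a vector space over it is a module record \<open>V\<close> with
  \<open>vectorspace class_ring V\<close>. An endomorphism of \<open>V\<close> is a function that is linear on
  \<open>carrier V\<close>; its values outside the carrier are irrelevant, so equations between
  endomorphisms are always stated pointwise on the carrier. Sequences indexed by
  \<open>0,\<dots>,d\<close> are functions on \<open>nat\<close> of which only the values at these indices matter.
\<close>

subsection \<open>Multiplicity-free maps and primitive idempotents\<close>

abbreviation endomorphism :: "('a::field, 'v) module \<Rightarrow> ('v \<Rightarrow> 'v) \<Rightarrow> bool" where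
  "endomorphism V B \<equiv> linear_map class_ring V V B"

definition eigen_space :: "('a::field, 'v) module \<Rightarrow> ('v \<Rightarrow> 'v) \<Rightarrow> 'a \<Rightarrow> 'v set" where
  "eigen_space V B t = {v \<in> carrier V. B v = t \<odot>\<^bsub>V\<^esub> v}"

definition eigen_value :: "('a::field, 'v) module \<Rightarrow> ('v \<Rightarrow> 'v) \<Rightarrow> 'a \<Rightarrow> bool" where
  "eigen_value V B t \<longleftrightarrow> (\<exists>v \<in> eigen_space V B t. v \<noteq> \<zero>\<^bsub>V\<^esub>)"

definition diagonalizable_map :: "('a::field, 'v) module \<Rightarrow> ('v \<Rightarrow> 'v) \<Rightarrow> bool" where
  "diagonalizable_map V B \<longleftrightarrow>
     (\<exists>S. vectorspace.basis class_ring V S \<and> (\<forall>v\<in>S. \<exists>t. v \<in> eigen_space V B t))"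

definition multiplicity_free :: "('a::field, 'v) module \<Rightarrow> ('v \<Rightarrow> 'v) \<Rightarrow> bool" where
  "multiplicity_free V B \<longleftrightarrow> endomorphism V B \<and> diagonalizable_map V B \<and>
     (\<forall>t. eigen_value V B t \<longrightarrow>
        vectorspace.dim class_ring (V\<lparr>carrier := eigen_space V B t\<rparr>) = 1)"

text \<open>For diagonalizable \<open>B\<close> the following determines \<open>E\<close> uniquely on \<open>carrier V\<close>.\<close>

definition primitive_idempotent ::
  "('a::field, 'v) module \<Rightarrow> ('v \<Rightarrow> 'v) \<Rightarrow> 'a \<Rightarrow> ('v \<Rightarrow> 'v) \<Rightarrow> bool" where
  "primitive_idempotent V B t E \<longleftrightarrow> eigen_value V B t \<and> endomorphism V E \<and>
     (\<forall>v \<in> eigen_space V B t. E v = v) \<and>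
     (\<forall>s. s \<noteq> t \<longrightarrow> (\<forall>v \<in> eigen_space V B s. E v = \<zero>\<^bsub>V\<^esub>))"

definition idempotent_ordering ::
  "nat \<Rightarrow> ('a::field, 'v) module \<Rightarrow> ('v \<Rightarrow> 'v) \<Rightarrow> (nat \<Rightarrow> 'v \<Rightarrow> 'v) \<Rightarrow> bool" where
  "idempotent_ordering d V B E \<longleftrightarrow>
     (\<exists>\<theta>. bij_betw \<theta> {0..d} {t. eigen_value V B t} \<and>
          (\<forall>i\<le>d. primitive_idempotent V B (\<theta> i) (E i)))"

definition zero_map :: "('a::field, 'v) module \<Rightarrow> ('v \<Rightarrow> 'v) \<Rightarrow> bool" where
  "zero_map V B \<longleftrightarrow> (\<forall>v \<in> carrier V. B v = \<zero>\<^bsub>V\<^esub>)"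

subsection \<open>CH systems and their isomorphisms\<close>

text \<open>A sequence \<open>(A; {E\<^sub>i}; A\<^sup>*; {E\<^sup>*\<^sub>i})\<close> of maps.\<close>

type_synonym 'v map_system =
  "('v \<Rightarrow> 'v) \<times> (nat \<Rightarrow> 'v \<Rightarrow> 'v) \<times> ('v \<Rightarrow> 'v) \<times> (nat \<Rightarrow> 'v \<Rightarrow> 'v)"

text \<open>
  Conditions (iv) and (v) in the definition of a CH system. The inequalities between
  differences of indices are rearranged so that no subtraction on \<open>nat\<close> occurs.
\<close>

definition circular_hessenberg ::
  "nat \<Rightarrow> ('a::field, 'v) module \<Rightarrow> (nat \<Rightarrow> 'v \<Rightarrow> 'v) \<Rightarrow> ('v \<Rightarrow> 'v) \<Rightarrow> bool" where
  "circular_hessenberg d V E B \<longleftrightarrow>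
     (\<forall>i\<le>d. \<forall>j\<le>d.
        ((j + 1 < i \<or> (i + 1 < j \<and> j < i + d)) \<longrightarrow> zero_map V (E i \<circ> B \<circ> E j)) \<and>
        ((i = j + 1 \<or> j = i + d) \<longrightarrow> \<not> zero_map V (E i \<circ> B \<circ> E j)))"

fun CH_system :: "nat \<Rightarrow> ('a::field, 'v) module \<Rightarrow> 'v map_system \<Rightarrow> bool" where
  "CH_system d V (A, E, As, Es) \<longleftrightarrow>
     vectorspace class_ring V \<and> vectorspace.fin_dim class_ring V \<and>
     vectorspace.dim class_ring V = d + 1 \<and>
     multiplicity_free V A \<and> multiplicity_free V As \<and>
     idempotent_ordering d V A E \<and> idempotent_ordering d V As Es \<and>
     circular_hessenberg d V E As \<and> circular_hessenberg d V Es A"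

text \<open>\<open>\<sigma> B \<sigma>\<^sup>-\<^sup>1 = B'\<close> is written as \<open>\<sigma> B = B' \<sigma>\<close>.\<close>

definition intertwines ::
  "('a::field, 'v) module \<Rightarrow> ('v \<Rightarrow> 'w) \<Rightarrow> ('v \<Rightarrow> 'v) \<Rightarrow> ('w \<Rightarrow> 'w) \<Rightarrow> bool" where
  "intertwines V \<sigma> B B' \<longleftrightarrow> (\<forall>v \<in> carrier V. \<sigma> (B v) = B' (\<sigma> v))"

fun CH_isomorphic ::
  "nat \<Rightarrow> ('a::field, 'v) module \<Rightarrow> 'v map_system \<Rightarrow> ('a, 'w) module \<Rightarrow> 'w map_system \<Rightarrow> bool"
  where
  "CH_isomorphic d V (A, E, As, Es) W (B, F, Bs, Fs) \<longleftrightarrow>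
     (\<exists>\<sigma>. linear_map class_ring V W \<sigma> \<and> bij_betw \<sigma> (carrier V) (carrier W) \<and>
          intertwines V \<sigma> A B \<and> intertwines V \<sigma> As Bs \<and>
          (\<forall>i\<le>d. intertwines V \<sigma> (E i) (F i) \<and> intertwines V \<sigma> (Es i) (Fs i)))"

subsection \<open>Bidiagonal form and parameters\<close>

definition lower_bidiag :: "nat \<Rightarrow> (nat \<Rightarrow> 'a::field) \<Rightarrow> 'a mat" where
  "lower_bidiag d \<theta> = mat (d + 1) (d + 1)
     (\<lambda>(i, j). if i = j then \<theta> (d - i) else if i = j + 1 then 1 else 0)"

definition upper_bidiag :: "nat \<Rightarrow> (nat \<Rightarrow> 'a::field) \<Rightarrow> (nat \<Rightarrow> 'a) \<Rightarrow> 'a mat" where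
  "upper_bidiag d \<theta>s \<phi> = mat (d + 1) (d + 1)
     (\<lambda>(i, j). if i = j then \<theta>s i else if j = i + 1 then \<phi> j else 0)"

definition ordered_basis :: "nat \<Rightarrow> ('a::field, 'v) module \<Rightarrow> (nat \<Rightarrow> 'v) \<Rightarrow> bool" where
  "ordered_basis d V v \<longleftrightarrow> inj_on v {0..d} \<and> vectorspace.basis class_ring V (v ` {0..d})"

definition represents ::
  "nat \<Rightarrow> ('a::field, 'v) module \<Rightarrow> (nat \<Rightarrow> 'v) \<Rightarrow> 'a mat \<Rightarrow> ('v \<Rightarrow> 'v) \<Rightarrow> bool" where
  "represents d V v M B \<longleftrightarrow>
     (\<forall>j\<le>d. B (v j) = (\<Oplus>\<^bsub>V\<^esub>i\<in>{0..d}. (M $$ (i, j)) \<odot>\<^bsub>V\<^esub> v i))"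

text \<open>
  \<open>\<theta> i\<close>, \<open>\<theta>s i\<close> \<open>(0 \<le> i \<le> d)\<close> are the eigenvalues for the idempotents of the system and
  \<open>\<phi> i\<close> \<open>(1 \<le> i \<le> d)\<close> is its split sequence. Since a CH system has exactly one
  such sequence of parameters, they are introduced by a relation.
\<close>

fun CH_parameters ::
  "nat \<Rightarrow> ('a::field, 'v) module \<Rightarrow> 'v map_system \<Rightarrow>
   (nat \<Rightarrow> 'a) \<Rightarrow> (nat \<Rightarrow> 'a) \<Rightarrow> (nat \<Rightarrow> 'a) \<Rightarrow> bool" where
  "CH_parameters d V (A, E, As, Es) \<theta> \<theta>s \<phi> \<longleftrightarrow>
     (\<forall>i\<le>d. primitive_idempotent V A (\<theta> i) (E i) \<and>
            primitive_idempotent V As (\<theta>s i) (Es i)) \<and>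
     (\<forall>i\<in>{1..d}. \<phi> i \<noteq> 0) \<and>
     (\<exists>v. ordered_basis d V v \<and> represents d V v (lower_bidiag d \<theta>) A \<and>
          represents d V v (upper_bidiag d \<theta>s \<phi>) As)"

definition vartheta ::
  "nat \<Rightarrow> (nat \<Rightarrow> 'a::field) \<Rightarrow> (nat \<Rightarrow> 'a) \<Rightarrow> (nat \<Rightarrow> 'a) \<Rightarrow> nat \<Rightarrow> 'a" where
  "vartheta d \<theta> \<theta>s \<phi> i =
     (if i = 0 \<or> i = d + 1 then 0
      else \<phi> i - (\<theta>s i - \<theta>s 0) * (\<theta> (d - i + 1) - \<theta> 0))"

definition beta_recurrent :: "'a::field \<Rightarrow> nat \<Rightarrow> (nat \<Rightarrow> 'a) \<Rightarrow> bool" where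
  "beta_recurrent \<beta> n s \<longleftrightarrow>
     (\<forall>i. 2 \<le> i \<and> i + 1 \<le> n \<longrightarrow>
        s (i - 2) - (\<beta> + 1) * s (i - 1) + (\<beta> + 1) * s i - s (i + 1) = 0)"

definition recurrent_CH :: "nat \<Rightarrow> ('a::field, 'v) module \<Rightarrow> 'v map_system \<Rightarrow> bool" where
  "recurrent_CH d V \<Phi> \<longleftrightarrow>
     (\<exists>\<theta> \<theta>s \<phi>. CH_parameters d V \<Phi> \<theta> \<theta>s \<phi> \<and>
        (\<exists>\<beta>. beta_recurrent \<beta> d \<theta> \<and> beta_recurrent \<beta> d \<theta>s \<and>
             beta_recurrent \<beta> (d + 1) (vartheta d \<theta> \<theta>s \<phi>)))"

subsection \<open>The four families\<close>

definition type_I :: "nat \<Rightarrow> (nat \<Rightarrow> 'a::field) \<Rightarrow> (nat \<Rightarrow> 'a) \<Rightarrow> (nat \<Rightarrow> 'a) \<Rightarrow> bool" where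
  "type_I d \<theta> \<theta>s \<phi> \<longleftrightarrow>
     (\<exists>(q :: 'a alg_closure) a b c as bs cs y z.
        q \<noteq> 0 \<and> q + inverse q \<in> range to_ac \<and>
        (\<forall>i\<in>{1..d}. q ^ i \<noteq> 1) \<and> q ^ (d + 1) = 1 \<and>
        (\<forall>i\<in>{1..2 * d - 1}. c \<noteq> b * q ^ i \<and> cs \<noteq> bs * q ^ i) \<and>
        y \<noteq> z \<and>
        (\<forall>i\<le>d. to_ac (\<theta> i) = a + b * q ^ i + c * inverse q ^ i \<and>
               to_ac (\<theta>s i) = as + bs * q ^ i + cs * inverse q ^ i) \<and>
        (\<forall>i\<in>{1..d}.
           to_ac (\<phi> i) =
             (q ^ i - 1) * (y - z * inverse q ^ i)
             + (q ^ i - 1) * (inverse q ^ i - 1) * (b - c * q ^ i) * (bs - cs * inverse q ^ i) \<and>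
           \<phi> i \<noteq> 0))"

definition type_II :: "nat \<Rightarrow> (nat \<Rightarrow> 'a::field) \<Rightarrow> (nat \<Rightarrow> 'a) \<Rightarrow> (nat \<Rightarrow> 'a) \<Rightarrow> bool" where
  "type_II d \<theta> \<theta>s \<phi> \<longleftrightarrow> CHAR('a) = d + 1 \<and>
     (\<exists>a b c as bs cs y z.
        (\<forall>i\<in>{1..2 * d - 1}. 2 * b \<noteq> c * (1 - of_nat i) \<and> 2 * bs \<noteq> cs * (1 - of_nat i)) \<and>
        2 * y \<noteq> z \<and>
        (\<forall>i\<le>d. \<theta> i = a + b * of_nat i + c * of_nat i * (of_nat i - 1) / 2 \<and>
               \<theta>s i = as + bs * of_nat i + cs * of_nat i * (of_nat i - 1) / 2) \<and>
        (\<forall>i\<in>{1..d}.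
           \<phi> i = of_nat i * (y + z * (of_nat i - 1) / 2)
             - (of_nat i)^2 * (b + c * (of_nat d - of_nat i) / 2)
                            * (bs + cs * (of_nat i - 1) / 2) \<and>
           \<phi> i \<noteq> 0))"

definition type_III :: "nat \<Rightarrow> (nat \<Rightarrow> 'a::field) \<Rightarrow> (nat \<Rightarrow> 'a) \<Rightarrow> (nat \<Rightarrow> 'a) \<Rightarrow> bool" where
  "type_III d \<theta> \<theta>s \<phi> \<longleftrightarrow> odd d \<and> d \<ge> 5 \<and> CHAR('a) = (d + 1) div 2 \<and>
     (\<exists>a b c as bs cs y z.
        b \<noteq> 0 \<and> bs \<noteq> 0 \<and> c \<noteq> 0 \<and> cs \<noteq> 0 \<and>
        (\<forall>i\<in>{1..2 * d - 1}. odd i \<longrightarrow>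
           2 * b \<noteq> - of_nat i * c \<and> 2 * bs \<noteq> - of_nat i * cs) \<and>
        z \<noteq> 0 \<and>
        (\<forall>i\<le>d. \<theta> i = a + b * (-1) ^ i + c * of_nat i * (-1) ^ i \<and>
               \<theta>s i = as + bs * (-1) ^ i + cs * of_nat i * (-1) ^ i) \<and>
        (\<forall>i\<in>{1..d}.
           \<phi> i = y * ((-1) ^ i - 1) + z * of_nat i * (-1) ^ i
             + (b * ((-1) ^ i - 1) - c * of_nat i * (-1) ^ i)
               * (bs * ((-1) ^ i - 1) + cs * of_nat i * (-1) ^ i) \<and>
           \<phi> i \<noteq> 0))"

text \<open>In characteristic 2: the image of \<open>n choose 2\<close>.\<close>

definition binom2 :: "nat \<Rightarrow> 'a::field" where
  "binom2 n = (if n mod 4 = 0 \<or> n mod 4 = 1 then 0 else 1)"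

definition type_IV :: "nat \<Rightarrow> (nat \<Rightarrow> 'a::field) \<Rightarrow> (nat \<Rightarrow> 'a) \<Rightarrow> (nat \<Rightarrow> 'a) \<Rightarrow> bool" where
  "type_IV d \<theta> \<theta>s \<phi> \<longleftrightarrow> d = 3 \<and> CHAR('a) = 2 \<and>
     (\<exists>a b c as bs cs y z.
        b \<noteq> 0 \<and> bs \<noteq> 0 \<and> c \<noteq> 0 \<and> cs \<noteq> 0 \<and> b \<noteq> c \<and> bs \<noteq> cs \<and>
        z \<noteq> 0 \<and>
        (\<forall>i\<le>3. \<theta> i = a + b * of_nat i + c * binom2 i \<and>
               \<theta>s i = as + bs * of_nat i + cs * binom2 i) \<and>
        (\<forall>i\<in>{1..3}.
           \<phi> i = y * of_nat i + z * binom2 i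
             + (b * of_nat i + c * binom2 (i + 1)) * (bs * of_nat i + cs * binom2 i) \<and>
           \<phi> i \<noteq> 0))"

text \<open>The systems on \<open>F\<^sup>d\<^sup>+\<^sup>1\<close> built from the scalars that satisfy a given condition.\<close>

definition CH_family ::
  "nat \<Rightarrow> ((nat \<Rightarrow> 'a::field) \<Rightarrow> (nat \<Rightarrow> 'a) \<Rightarrow> (nat \<Rightarrow> 'a) \<Rightarrow> bool) \<Rightarrow> 'a vec map_system set" where
  "CH_family d P =
     {((*\<^sub>v) (lower_bidiag d \<theta>), E, (*\<^sub>v) (upper_bidiag d \<theta>s \<phi>), Es) | \<theta> \<theta>s \<phi> E Es.
        P \<theta> \<theta>s \<phi> \<and>
        (\<forall>i\<le>d. primitive_idempotent (module_vec TYPE('a) (d + 1))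
                  ((*\<^sub>v) (lower_bidiag d \<theta>)) (\<theta> i) (E i) \<and>
               primitive_idempotent (module_vec TYPE('a) (d + 1))
                  ((*\<^sub>v) (upper_bidiag d \<theta>s \<phi>)) (\<theta>s i) (Es i))}"

end

theory Submission
  imports Defs
begin

text \<open>
  In split coordinates \<open>A\<close> and \<open>A\<^sup>*\<close> are bidiagonal, so everything depends on the three
  \<open>\<beta>\<close>-recurrent sequences \<open>\<theta>\<close>, \<open>\<theta>\<^sup>*\<close>, \<open>\<vartheta>\<close> alone. Their general form is determined by the roots
  of \<open>x\<^sup>2 - \<beta> x + 1\<close>; what has to be excluded are the parameters of Leonard type, that is
  \<open>\<vartheta>\<^sub>i = \<vartheta>\<^sub>d\<^sub>+\<^sub>1\<^sub>-\<^sub>i\<close> for all \<open>i\<close>. If \<open>\<vartheta>\<close> is symmetric in this sense, then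
  \<open>K \<vartheta>\<^sub>i = p\<^sub>i (\<theta>\<^sup>*\<^sub>d - \<theta>\<^sup>*\<^sub>i\<^sub>-\<^sub>1) + p\<^sub>i\<^sub>-\<^sub>1 (\<theta>\<^sup>*\<^sub>i - \<theta>\<^sup>*\<^sub>0)\<close> with an explicit constant \<open>K \<noteq> 0\<close> and a
  sequence \<open>p\<close> that vanishes at \<open>0\<close> and \<open>d\<close> (for \<open>\<beta> = q + q\<^sup>-\<^sup>1\<close> take
  \<open>p\<^sub>i = (1 - q\<^sup>i) (1 - q\<^sup>d\<^sup>-\<^sup>i)\<close>), and this identity forces \<open>E\<^sup>*\<^sub>0 A E\<^sup>*\<^sub>d = 0\<close>.
  Hence \<open>\<vartheta>\<close> is not symmetric; since \<open>\<vartheta>\<^sub>0 = \<vartheta>\<^sub>d\<^sub>+\<^sub>1 = 0\<close>, this is only possible if the recurrence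
  has period \<open>d + 1\<close>, which is the condition on \<open>q\<close> or on the characteristic in the four families.
\<close>

unbundle no fps_syntax

subsection \<open>Recurrent sequences\<close>

text \<open>The recurrence has order three: its instance at \<open>k + 2\<close> determines the
  value at \<open>k + 3\<close> from the three values before it.\<close>

lemma beta_recurrent_unique:
  assumes s: "beta_recurrent \<beta> n s" and t: "beta_recurrent \<beta> n t"
    and init: "s 0 = t 0" "s 1 = t 1" "s 2 = t 2" and "i \<le> n"
  shows "s i = t i"
  using \<open>i \<le> n\<close>
proof (induction i rule: less_induct)
  case (less i)
  show ?case
  proof (cases "i \<le> 2")
    case True
    then have "i = 0 \<or> i = 1 \<or> i = 2" by auto
    with init show ?thesis by auto
  next
    case False
    define k where "k = i - 3"
    have k: "i = k + 3" using False by (simp add: k_def)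
    have "2 \<le> k + 2 \<and> k + 2 + 1 \<le> n" using less.prems k by simp
    then have "s k - (\<beta> + 1) * s (k + 1) + (\<beta> + 1) * s (k + 2) - s (k + 3) = 0"
      and "t k - (\<beta> + 1) * t (k + 1) + (\<beta> + 1) * t (k + 2) - t (k + 3) = 0"
      using s[unfolded beta_recurrent_def, rule_format, of "k + 2"]
        t[unfolded beta_recurrent_def, rule_format, of "k + 2"]
      by (simp_all add: numeral_3_eq_3)
    moreover have "s k = t k" "s (k + 1) = t (k + 1)" "s (k + 2) = t (k + 2)"
      using less.IH less.prems k by auto
    ultimately show ?thesis using k by simp
  qed
qed

lemma beta_recurrentI:
  assumes "\<And>k. k + 3 \<le> n \<Longrightarrow> s k - (\<beta> + 1) * s (k + 1) + (\<beta> + 1) * s (k + 2) - s (k + 3) = 0"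
  shows "beta_recurrent \<beta> n s"
  unfolding beta_recurrent_def
proof (intro allI impI)
  fix i assume "2 \<le> i \<and> i + 1 \<le> n"
  moreover define k where "k = i - 2"
  ultimately have "i = k + 2" "k + 3 \<le> n" by auto
  then show "s (i - 2) - (\<beta> + 1) * s (i - 1) + (\<beta> + 1) * s i - s (i + 1) = 0"
    using assms[of k] by (simp add: numeral_3_eq_3)
qed

section \<open>Closed forms of \<beta>-recurrent sequences\<close>

text \<open>The characteristic polynomial is \<open>(x - 1) * (x\<^sup>2 - \<beta> * x + 1)\<close>.
  Since \<open>q\<^sup>2 \<noteq> 1\<close>, its roots \<open>1\<close>, \<open>q\<close> and
  \<open>inverse q\<close> are distinct, so their powers span the solutions.\<close>

lemma beta_recurrent_generic_form:
  fixes q :: "'a::field"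
  assumes s: "beta_recurrent (q + inverse q) n s" and q: "q \<noteq> 0" "q\<^sup>2 \<noteq> 1"
  obtains a b c where "\<And>i. i \<le> n \<Longrightarrow> s i = a + b * q ^ i + c * inverse q ^ i"
proof -
  define r where "r = inverse q"
  have qr: "q * r = 1" "r * q = 1" using q by (auto simp: r_def)
  have q1: "q \<noteq> 1" using q by auto
  have q': "q - r \<noteq> 0"
    using q qr by (metis eq_iff_diff_eq_0 power2_eq_square)
  \<comment> \<open>Divided differences remove the constant \<open>a\<close>. The formulas for
    \<open>b\<close> and \<open>c\<close> solve \<open>m1 = b - c * r\<close> and
    \<open>m2 = b * q - c * r * r\<close>.\<close>
  define m1 where "m1 = (s 1 - s 0) / (q - 1)"
  define m2 where "m2 = (s 2 - s 1) / (q - 1)"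
  define b where "b = (m2 - r * m1) / (q - r)"
  define c where "c = q * (m2 - q * m1) / (q - r)"
  define a where "a = s 0 - b - c"
  have s10: "s 1 - s 0 = m1 * (q - 1)" and s21: "s 2 - s 1 = m2 * (q - 1)"
    using q1 by (auto simp: m1_def m2_def)
  have B: "b * (q - r) = m2 - r * m1" and C: "c * (q - r) = q * (m2 - q * m1)"
    using q' by (auto simp: b_def c_def)
  have "(b - c * r) * (q - r) = b * (q - r) - r * (c * (q - r))"
    by (simp add: algebra_simps)
  also have "\<dots> = m1 * (q - r) + (1 - q * r) * (m2 - q * m1)"
    unfolding B C by (simp add: algebra_simps)
  finally have m1: "m1 = b - c * r" using q' qr by simp
  have "(b * q - c * r * r) * (q - r) = q * (b * (q - r)) - r * r * (c * (q - r))"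
    by (simp add: algebra_simps)
  also have "\<dots> = m2 * (q - r) + (1 - q * r) * (r * m2 - q * m1 - q * r * m1 + q * m1)"
    unfolding B C by (simp add: algebra_simps)
  finally have m2: "m2 = b * q - c * r * r" using q' qr by simp
  have "s i = a + b * q ^ i + c * r ^ i" if "i \<le> n" for i
  proof (rule beta_recurrent_unique[OF s _ _ _ _ that])
    show "beta_recurrent (q + inverse q) n (\<lambda>i. a + b * q ^ i + c * r ^ i)"
      unfolding r_def[symmetric]
    proof (rule beta_recurrentI)
      fix k :: nat
      show "a + b * q ^ k + c * r ^ k - (q + r + 1) * (a + b * q ^ (k + 1) + c * r ^ (k + 1)) +
        (q + r + 1) * (a + b * q ^ (k + 2) + c * r ^ (k + 2)) -
        (a + b * q ^ (k + 3) + c * r ^ (k + 3)) = 0"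
    (is "?e = 0")
      proof -
        have "?e = b * q ^ k * ((1 - q * r) * (1 - q)) + c * r ^ k * ((1 - q * r) * (1 - r))"
          by (simp add: algebra_simps power_add power2_eq_square power3_eq_cube)
        then show ?thesis using qr by simp
      qed
    qed
    show "s 0 = a + b * q ^ 0 + c * r ^ 0" by (simp add: a_def)
    have "s 1 = s 0 + (b - c * r) * (q - 1)" using s10 m1 by (simp add: algebra_simps)
    also have "\<dots> = a + b * q + c * r + c * (1 - q * r)" by (simp add: a_def algebra_simps)
    finally show s1: "s 1 = a + b * q ^ 1 + c * r ^ 1" using qr by simp
    have "s 2 = s 1 + (b * q - c * r * r) * (q - 1)" using s21 m2 by (simp add: algebra_simps)
    also have "\<dots> = a + b * q\<^sup>2 + c * r\<^sup>2 + c * r * (1 - q * r)"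
      by (subst s1) (simp add: algebra_simps power2_eq_square)
    finally show "s 2 = a + b * q\<^sup>2 + c * r\<^sup>2" using qr by simp
  qed
  then show ?thesis using that unfolding r_def by blast
qed

text \<open>For \<open>\<beta> = 2\<close> the characteristic polynomial is
  \<open>(x - 1) ^ 3\<close>; outside characteristic 2 the solutions are the polynomials of degree
  at most two in the index.\<close>

lemma beta_recurrent_2_form:
  fixes s :: "nat \<Rightarrow> 'a::field"
  assumes s: "beta_recurrent 2 n s" and two: "(2::'a) \<noteq> 0"
  obtains a b c where "\<And>i. i \<le> n \<Longrightarrow> s i = a + b * of_nat i + c * of_nat i * (of_nat i - 1) / 2"
proof -
  define e where "e = (s 2 - 2 * s 1 + s 0) / 2"
  let ?t = "\<lambda>i. s 0 + (s 1 - s 0) * of_nat i + e * of_nat i * (of_nat i - 1)"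
  have e2: "2 * e = s 2 - 2 * s 1 + s 0" using two by (simp add: e_def)
  have "s i = ?t i" if "i \<le> n" for i
  proof (rule beta_recurrent_unique[OF s _ _ _ _ that])
    show "beta_recurrent 2 n ?t"
      by (rule beta_recurrentI) (simp add: algebra_simps)
    show "s 2 = ?t 2" using e2 by (simp add: algebra_simps)
  qed simp_all
  moreover have "?t i = s 0 + (s 1 - s 0) * of_nat i + 2 * e * of_nat i * (of_nat i - 1) / 2" for i
    using two by simp
  ultimately have "s i = s 0 + (s 1 - s 0) * of_nat i + 2 * e * of_nat i * (of_nat i - 1) / 2"
    if "i \<le> n" for i using that by metis
  then show ?thesis by (rule that)
qed

text \<open>For \<open>\<beta> = -2\<close> the root \<open>-1\<close> is double, and it differs
  from the simple root \<open>1\<close> because \<open>2 \<noteq> 0\<close>.\<close>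

lemma beta_recurrent_minus_2_form:
  fixes s :: "nat \<Rightarrow> 'a::field"
  assumes s: "beta_recurrent (-2) n s" and two: "(2::'a) \<noteq> 0"
  obtains a b c where "\<And>i. i \<le> n \<Longrightarrow> s i = a + b * (-1) ^ i + c * of_nat i * (-1) ^ i"
proof -
  define c where "c = (s 2 - s 0) / 2"
  define b where "b = (s 0 - s 1 - c) / 2"
  define a where "a = s 0 - b"
  let ?t = "\<lambda>i. a + b * (-1) ^ i + c * of_nat i * (-1) ^ i"
  have c2: "c * 2 = s 2 - s 0" and b2: "b * 2 = s 0 - s 1 - c"
    using two by (simp_all add: b_def c_def)
  have "s i = ?t i" if "i \<le> n" for i
  proof (rule beta_recurrent_unique[OF s _ _ _ _ that])
    show "beta_recurrent (-2) n ?t"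
      by (rule beta_recurrentI) (simp add: algebra_simps power_add power3_eq_cube)
    show "s 1 = ?t 1"
      unfolding a_def power_one_right of_nat_1 using b2 by Groebner_Basis.algebra
    show "s 2 = ?t 2"
      unfolding a_def using c2 by simp
  qed (simp add: a_def)
  then show ?thesis using that by blast
qed

text \<open>These pairs turn distinctness of the eigenvalues into conditions on the index sum
  \<open>m\<close>, in the range that the families require.\<close>

lemma distinct_pair_with_sum:
  fixes d m :: nat
  assumes "m \<in> {1..2 * d - 1}"
  obtains i j where "i \<le> d" "j \<le> d" "i \<noteq> j" "i + j = m"
proof (cases "m \<le> d")
  case True
  with assms that[of m 0] show ?thesis by auto
next
  case False
  with assms that[of d "m - d"] show ?thesis by auto
qed

text \<open>
  The existence of such an \<open>r\<close> makes the corner \<open>E\<^sup>*\<^sub>0 A E\<^sup>*\<^sub>d\<close> vanish when \<open>s = \<theta>\<^sup>*\<close> and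
  \<open>t = \<vartheta>\<close>. The index of the paper is \<open>k + 1\<close>.
\<close>

definition corner_sequence ::
  "nat \<Rightarrow> (nat \<Rightarrow> 'a::field) \<Rightarrow> (nat \<Rightarrow> 'a) \<Rightarrow> (nat \<Rightarrow> 'a) \<Rightarrow> bool" where
  "corner_sequence d s t r \<longleftrightarrow> r 0 = 0 \<and> r d = 0 \<and>
     (\<forall>k<d. t (k + 1) = r (k + 1) * (s d - s k) + r k * (s (k + 1) - s 0))"

text \<open>Each case of the classification proves its identity with the denominator
  \<open>K\<close> cleared; here it is divided out.\<close>

lemma corner_sequence_scaled:
  assumes "p 0 = 0" "p d = 0" "K \<noteq> 0"
    and "\<And>k. k < d \<Longrightarrow> t (k + 1) * K = \<zeta> * (p (k + 1) * (s d - s k) + p k * (s (k + 1) - s 0))"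
  shows "corner_sequence d s t (\<lambda>i. \<zeta> * p i / K)"
  unfolding corner_sequence_def
proof (intro conjI allI impI)
  fix k assume "k < d"
  then have "t (k + 1) = \<zeta> * (p (k + 1) * (s d - s k) + p k * (s (k + 1) - s 0)) / K"
    using assms(3,4) by (metis nonzero_mult_div_cancel_right)
  then show "t (k + 1) = \<zeta> * p (k + 1) / K * (s d - s k) + \<zeta> * p k / K * (s (k + 1) - s 0)"
    by (simp add: add_divide_distrib distrib_left mult.assoc)
qed (use assms in simp_all)

text \<open>Since \<open>s d\<close> differs from every earlier \<open>s k\<close>, the defining
  equation can be solved for \<open>r (k + 1)\<close>. Starting from \<open>r 0 = 0\<close>, the
  values up to index \<open>d\<close> therefore stay in the base field.\<close>

lemma corner_sequence_of_alg_closure: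
  fixes s t :: "nat \<Rightarrow> 'a::field"
  assumes r: "corner_sequence d (\<lambda>i. to_ac (s i)) (\<lambda>i. to_ac (t i)) r"
    and s: "\<And>k. k < d \<Longrightarrow> s d \<noteq> s k"
  shows "\<exists>r'. corner_sequence d s t r'"
proof
  let ?r = "\<lambda>i. of_ac (r i)"
  have rec: "to_ac (t (k + 1)) = r (k + 1) * (to_ac (s d) - to_ac (s k))
      + r k * (to_ac (s (k + 1)) - to_ac (s 0))" if "k < d" for k
    using r that unfolding corner_sequence_def by blast
  have "r i \<in> range to_ac" if "i \<le> d" for i
    using that
  proof (induction i)
    case 0
    have "r 0 = to_ac 0" using r by (simp add: corner_sequence_def)
    then show ?case by blast
  next
    case (Suc k)
    then obtain x where x: "r k = to_ac x" by auto
    have "r (k + 1) = (to_ac (t (k + 1)) - r k * (to_ac (s (k + 1)) - to_ac (s 0)))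
        / (to_ac (s d) - to_ac (s k))"
      using s[of k] rec[of k] Suc.prems by (simp add: field_simps)
    also have "\<dots> = to_ac ((t (k + 1) - x * (s (k + 1) - s 0)) / (s d - s k))"
      by (simp add: x)
    finally have "r (k + 1) \<in> range to_ac" by (rule range_eqI)
    then show ?case by simp
  qed
  then have r': "r i = to_ac (?r i)" if "i \<le> d" for i
    using that by (simp add: to_ac_of_ac)
  have "to_ac (t (k + 1)) = to_ac (?r (k + 1) * (s d - s k) + ?r k * (s (k + 1) - s 0))"
    if "k < d" for k
    using rec[OF that] r'[of k] r'[of "k + 1"] that by simp
  moreover have "to_ac (?r 0) = to_ac 0" "to_ac (?r d) = to_ac 0"
    using r r'[of 0] r'[of d] by (simp_all add: corner_sequence_def)
  ultimately show "corner_sequence d s t ?r"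
    unfolding corner_sequence_def by (simp only: to_ac_eq_iff) simp
qed

section \<open>Scalar parameters of a recurrent system\<close>

text \<open>The classification concerns scalars alone. The last assumption is what it uses of the
  condition that \<open>Es 0 \<circ> A \<circ> Es d\<close> is not zero.\<close>

locale recurrent_parameters =
  fixes d :: nat and \<theta> \<theta>s \<phi> :: "nat \<Rightarrow> 'a::field" and \<beta> :: 'a
  assumes d3: "d \<ge> 3"
    and inj: "inj_on \<theta> {0..d}" "inj_on \<theta>s {0..d}"
    and phi_nonzero: "i \<in> {1..d} \<Longrightarrow> \<phi> i \<noteq> 0"
    and recurrent: "beta_recurrent \<beta> d \<theta>" "beta_recurrent \<beta> d \<theta>s"
      "beta_recurrent \<beta> (d + 1) (vartheta d \<theta> \<theta>s \<phi>)"
    and no_corner_sequence: "\<not> corner_sequence d \<theta>s (vartheta d \<theta> \<theta>s \<phi>) r"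
begin

abbreviation "\<omega> \<equiv> vartheta d \<theta> \<theta>s \<phi>"

lemma theta_neq:
  assumes "i \<le> d" "j \<le> d" "i \<noteq> j"
  shows "\<theta> i \<noteq> \<theta> j" "\<theta>s i \<noteq> \<theta>s j"
  using inj assms by (auto dest: inj_onD)

lemma omega_ends: "\<omega> 0 = 0" "\<omega> (d + 1) = 0"
  by (simp_all add: vartheta_def)

lemma phi_eq:
  assumes "i \<in> {1..d}"
  shows "\<phi> i = \<omega> i + (\<theta>s i - \<theta>s 0) * (\<theta> (d + 1 - i) - \<theta> 0)"
proof -
  have "d - i + 1 = d + 1 - i" using assms by auto
  then show ?thesis using assms by (simp add: vartheta_def)
qed

lemma no_alg_closure_corner_sequence:
  "\<not> corner_sequence d (\<lambda>i. to_ac (\<theta>s i)) (\<lambda>i. to_ac (\<omega> i)) r"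
  using corner_sequence_of_alg_closure[of d \<theta>s \<omega> r] theta_neq(2)[of d] no_corner_sequence
  by auto

end

section \<open>Distinct roots: \<open>q\<^sup>2 \<noteq> 1\<close>\<close>

lemma generic_difference:
  fixes q :: "'a::field"
  assumes "q \<noteq> 0"
  shows "(a + b * q ^ i + c * inverse q ^ i) - (a + b * q ^ j + c * inverse q ^ j)
    = (q ^ i - q ^ j) * (b - c * inverse q ^ (i + j))"
  using assms by (simp add: field_simps power_add)

text \<open>For \<open>i = k + 1\<close> the first two factors form
  \<open>(1 - q ^ i) * (1 - q ^ (d + 1 - i))\<close>, which is unchanged by
  \<open>i \<mapsto> d + 1 - i\<close>; this is the shape of a symmetric \<open>\<vartheta>\<close>.
  The remaining product is the constant \<open>K\<close>.\<close>

lemma generic_corner_identity: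
  fixes q :: "'a::field"
  assumes q: "q \<noteq> 0" and s: "\<And>i. i \<le> d \<Longrightarrow> s i = a + b * q ^ i + c * inverse q ^ i"
    and p: "\<And>i. p i = (1 - q ^ i) * (1 - q ^ d * inverse q ^ i)" and k: "k < d"
  shows "(1 - q ^ (k + 1)) * (1 - q ^ (d + 1) * inverse q ^ (k + 1))
      * ((q ^ d * inverse q - 1) * (b - c * inverse q ^ d))
    = p (k + 1) * (s d - s k) + p k * (s (k + 1) - s 0)"
proof -
  \<comment> \<open>Powers and their inverses get names, which leaves polynomial algebra modulo
    \<open>q * r = 1\<close>, \<open>Q * R = 1\<close> and \<open>D * E = 1\<close>.\<close>
  define r Q R D E where "r = inverse q" "Q = q ^ k" "R = r ^ k" "D = q ^ d" "E = r ^ d"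
  have qr: "q * r = 1" and QR: "Q * R = 1" and DE: "D * E = 1"
    using q by (simp_all add: r_Q_R_D_E_def flip: power_mult_distrib)
  have DQ: "D - Q = - Q * (1 - D * R)"
    using QR by (simp add: algebra_simps)
  have "s d - s k = (D - Q) * (b - c * (E * R))"
    using s[of d] s[of k] k generic_difference[OF q, of a b d c k]
    by (simp add: r_Q_R_D_E_def power_add)
  then have 1: "s d - s k = - Q * (1 - D * R) * (b - c * (E * R))"
    using DQ by simp
  have 2: "s (k + 1) - s 0 = (Q * q - 1) * (b - c * (R * r))"
    using s[of "k + 1"] s[of 0] k generic_difference[OF q, of a b "k + 1" c 0]
    by (simp add: r_Q_R_D_E_def mult.commute)
  have 3: "p (k + 1) = (1 - Q * q) * (1 - D * (R * r))" "p k = (1 - Q) * (1 - D * R)"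
    by (simp_all add: p r_Q_R_D_E_def mult.commute)
  have 4: "q ^ (d + 1) * inverse q ^ (k + 1) = D * R" "q ^ (k + 1) = Q * q"
    using q by (simp_all add: r_Q_R_D_E_def)
  \<comment> \<open>The claimed identity with the common factor
    \<open>(1 - Q * q) * (1 - D * R)\<close> removed.\<close>
  have 5: "(D * r - 1) * (b - c * E) = - Q * (b - c * (E * R)) * (1 - D * (R * r)) - (1 - Q) * (b - c * (R * r))"
    using qr QR DE by Groebner_Basis.algebra
  have "(1 - Q * q) * (1 - D * R) * ((D * r - 1) * (b - c * E))
    = (1 - Q * q) * (1 - D * (R * r)) * (- Q * (1 - D * R) * (b - c * (E * R)))
      + (1 - Q) * (1 - D * R) * ((Q * q - 1) * (b - c * (R * r)))"
    unfolding 5 by (simp add: algebra_simps)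
  then show ?thesis
    unfolding 1 2 3 4 unfolding r_Q_R_D_E_def .
qed

text \<open>If \<open>q ^ (d + 1) \<noteq> 1\<close> or \<open>y = z\<close>, then
  \<open>\<vartheta>\<close> is symmetric, which \<open>not_symmetric\<close> refutes. The
  inequalities for \<open>q\<close>, \<open>b\<close>, \<open>c\<close>, \<open>bs\<close>,
  \<open>cs\<close> come from distinctness of the eigenvalues.\<close>

lemma (in recurrent_parameters) type_I:
  assumes q: "q \<noteq> 0" "q\<^sup>2 \<noteq> 1" and \<beta>: "to_ac \<beta> = q + inverse q"
  shows "type_I d \<theta> \<theta>s \<phi>"
proof -
  let ?r = "inverse q"
  \<comment> \<open>\<open>q\<close> need not lie in the base field, so the recurrences are solved
    over the algebraic closure.\<close>
  have lift: "beta_recurrent (q + inverse q) n (\<lambda>i. to_ac (s i))"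
    if "beta_recurrent \<beta> n s" for n s
    using that unfolding beta_recurrent_def \<beta>[symmetric]
    by (metis (no_types, lifting) to_ac_0 to_ac_1 to_ac_add to_ac_diff to_ac_mult)
  obtain a b c where th: "\<And>i. i \<le> d \<Longrightarrow> to_ac (\<theta> i) = a + b * q ^ i + c * ?r ^ i"
    using beta_recurrent_generic_form[OF lift[OF recurrent(1)] q] by metis
  obtain as bs cs where ths: "\<And>i. i \<le> d \<Longrightarrow> to_ac (\<theta>s i) = as + bs * q ^ i + cs * ?r ^ i"
    using beta_recurrent_generic_form[OF lift[OF recurrent(2)] q] by metis
  obtain x y z where om: "\<And>i. i \<le> d + 1 \<Longrightarrow> to_ac (\<omega> i) = x + y * q ^ i + z * ?r ^ i"
    using beta_recurrent_generic_form[OF lift[OF recurrent(3)] q] by metis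
  have x: "x = - y - z"
    using om[of 0] by (simp add: omega_ends algebra_simps) (metis add.assoc add_eq_0_iff2 minus_add_distrib)
  have om': "to_ac (\<omega> i) = (q ^ i - 1) * (y - z * ?r ^ i)" if "i \<le> d + 1" for i
    using om[OF that] q(1) unfolding x by (simp add: field_simps)
  have diff: "to_ac (\<theta> i) - to_ac (\<theta> j) = (q ^ i - q ^ j) * (b - c * ?r ^ (i + j))"
    "to_ac (\<theta>s i) - to_ac (\<theta>s j) = (q ^ i - q ^ j) * (bs - cs * ?r ^ (i + j))"
    if "i \<le> d" "j \<le> d" for i j
    using th ths that generic_difference[OF q(1)] by metis+
  have neq: "q ^ i \<noteq> q ^ j" "b \<noteq> c * ?r ^ (i + j)" "bs \<noteq> cs * ?r ^ (i + j)"
    if "i \<le> d" "j \<le> d" "i \<noteq> j" for i j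
    using diff[OF that(1,2)] theta_neq[OF that] by auto
  have q_pow: "q ^ i \<noteq> 1" if "i \<in> {1..d}" for i
    using neq(1)[of i 0] that by auto
  have bc: "c \<noteq> b * q ^ m" "cs \<noteq> bs * q ^ m" if "m \<in> {1..2 * d - 1}" for m
  proof -
    obtain i j where "i \<le> d" "j \<le> d" "i \<noteq> j" "i + j = m"
      using distinct_pair_with_sum \<open>m \<in> _\<close> by metis
    then have "b \<noteq> c * ?r ^ m" "bs \<noteq> cs * ?r ^ m" using neq(2,3)[of i j] by auto
    moreover have "q ^ m * ?r ^ m = 1" using q(1) by (simp flip: power_mult_distrib)
    ultimately show "c \<noteq> b * q ^ m" "cs \<noteq> bs * q ^ m"
      by (auto simp: mult.assoc)
  qed
  have not_symmetric: False
    if om_sym: "\<And>k. k < d \<Longrightarrow> to_ac (\<omega> (k + 1)) = \<zeta> * ((1 - q ^ (k + 1)) * (1 - q ^ (d + 1) * ?r ^ (k + 1)))"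
    for \<zeta>
  proof -
    let ?p = "\<lambda>i. (1 - q ^ i) * (1 - q ^ d * ?r ^ i)"
    let ?K = "(q ^ d * ?r - 1) * (bs - cs * ?r ^ d)"
    \<comment> \<open>The first factor of \<open>?K\<close> is \<open>q ^ (d - 1) - 1\<close>, the
      second divides \<open>\<theta>s d - \<theta>s 0\<close>; neither vanishes.\<close>
    have "q ^ d * ?r = q ^ (d - 1)"
      using q(1) d3 by (simp add: power_diff divide_inverse)
    then have "?K \<noteq> 0"
      using neq(3)[of d 0] q_pow[of "d - 1"] d3 by simp
    moreover have "?p d = 0" using q(1) by (simp flip: power_mult_distrib)
    moreover have "to_ac (\<omega> (k + 1)) * ?K = \<zeta> * (?p (k + 1) * (to_ac (\<theta>s d) - to_ac (\<theta>s k))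
        + ?p k * (to_ac (\<theta>s (k + 1)) - to_ac (\<theta>s 0)))" if "k < d" for k
      unfolding om_sym[OF that] mult.assoc[of \<zeta>]
      by (subst generic_corner_identity[OF q(1) ths, where p = ?p]) (use that in simp_all)
    ultimately have "corner_sequence d (\<lambda>i. to_ac (\<theta>s i)) (\<lambda>i. to_ac (\<omega> i)) (\<lambda>i. \<zeta> * ?p i / ?K)"
      by (intro corner_sequence_scaled) auto
    then show False using no_alg_closure_corner_sequence by blast
  qed
  have qr: "q ^ i * ?r ^ i = 1" for i using q(1) by (simp flip: power_mult_distrib)
  have period: "q ^ (d + 1) = 1"
  proof (rule ccontr)
    assume "q ^ (d + 1) \<noteq> 1"
    \<comment> \<open>The value of \<open>\<vartheta>\<close> at \<open>d + 1\<close> is zero and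
      its factor \<open>q ^ (d + 1) - 1\<close> is not, which fixes \<open>y\<close>.\<close>
    then have y: "y = z * ?r ^ (d + 1)" using om'[of "d + 1"] omega_ends by simp
    have rearrange: "(A - 1) * (z * W - (D * W) * z * R) = - z * W * ((1 - A) * (1 - D * R))"
      for A W D R by (simp add: algebra_simps)
    show False
    proof (rule not_symmetric[of "- z * ?r ^ (d + 1)"])
      fix k assume "k < d"
      then have "to_ac (\<omega> (k + 1)) = (q ^ (k + 1) - 1) * (z * ?r ^ (d + 1) - z * ?r ^ (k + 1))"
        using om'[of "k + 1"] y by simp
      \<comment> \<open>The inserted factor is \<open>1\<close>; it gives the term the form of the
        left side of \<open>rearrange\<close>.\<close>
      also have "\<dots> = (q ^ (k + 1) - 1) * (z * ?r ^ (d + 1) - (q ^ (d + 1) * ?r ^ (d + 1)) * z * ?r ^ (k + 1))"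
        unfolding qr by simp
      also have "\<dots> = - z * ?r ^ (d + 1) * ((1 - q ^ (k + 1)) * (1 - q ^ (d + 1) * ?r ^ (k + 1)))"
        by (rule rearrange)
      finally show "to_ac (\<omega> (k + 1)) = \<dots>" .
    qed
  qed
  have yz: "y \<noteq> z"
  proof
    assume "y = z"
    \<comment> \<open>With period \<open>d + 1\<close> the second factor of the symmetric shape is
      \<open>1 - ?r ^ i\<close>, so equal \<open>y\<close> and \<open>z\<close> produce that shape
      with \<open>\<zeta> = - z\<close>.\<close>
    have rearrange: "(A - 1) * (z - z * R) = - z * ((1 - A) * (1 - 1 * R))" for A R
      by (simp add: algebra_simps)
    show False
      by (rule not_symmetric[of "- z"], unfold period, subst om')
        (simp, unfold \<open>y = z\<close>, rule rearrange)
  qed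
  have phi: "to_ac (\<phi> i) = (q ^ i - 1) * (y - z * ?r ^ i)
      + (q ^ i - 1) * (?r ^ i - 1) * (b - c * q ^ i) * (bs - cs * ?r ^ i)" if i: "i \<in> {1..d}" for i
  proof -
    \<comment> \<open>By periodicity \<open>i \<mapsto> d + 1 - i\<close> exchanges
      \<open>q ^ i\<close> and \<open>?r ^ i\<close>.\<close>
    have "q ^ (d + 1 - i) * q ^ i = 1" using i period by (simp flip: power_add)
    then have flip: "q ^ (d + 1 - i) = ?r ^ i" using q(1)
      by (metis inverse_unique mult.commute power_inverse)
    then have flip': "?r ^ (d + 1 - i) = q ^ i" using q(1)
      by (metis inverse_inverse_eq power_inverse)
    have le: "d + 1 - i \<le> d" using i by auto
    have "to_ac (\<theta>s i) - to_ac (\<theta>s 0) = (q ^ i - 1) * (bs - cs * ?r ^ i)"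
      using diff(2)[of i 0] i by simp
    moreover have "to_ac (\<theta> (d + 1 - i)) - to_ac (\<theta> 0) = (?r ^ i - 1) * (b - c * q ^ i)"
      using diff(1)[OF le, of 0] flip flip' by simp
    ultimately show ?thesis
      using i by (simp add: phi_eq om' mult.assoc mult.left_commute)
  qed
  have range: "q + ?r \<in> range to_ac" using \<beta>[symmetric] by (rule range_eqI)
  show ?thesis
    unfolding type_I_def
    by (rule exI[of _ q], rule exI[of _ a], rule exI[of _ b], rule exI[of _ c],
        rule exI[of _ as], rule exI[of _ bs], rule exI[of _ cs], rule exI[of _ y],
        rule exI[of _ z], intro conjI ballI allI impI)
      (simp_all only: q(1) range q_pow period bc yz th ths phi phi_nonzero not_False_eq_True)
qed

section \<open>Triple root 1 outside characteristic 2\<close>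

lemma CHAR_eqI:
  assumes "n > 0" "of_nat n = (0::'a::semiring_1_cancel)"
    and "\<And>k. 0 < k \<Longrightarrow> k < n \<Longrightarrow> of_nat k \<noteq> (0::'a)"
  shows "CHAR('a) = n"
proof (rule ccontr)
  have "CHAR('a) dvd n" using assms(2) by (simp add: of_nat_eq_0_iff_char_dvd)
  then have "0 < CHAR('a)" "CHAR('a) \<le> n"
    using assms(1) by (auto intro!: Nat.gr0I dest: dvd_imp_le)
  moreover assume "CHAR('a) \<noteq> n"
  ultimately show False using assms(3)[of "CHAR('a)"] by simp
qed

lemma quadratic_difference:
  fixes x y :: "'a::field"
  shows "(a + b * x + c * x * (x - 1) / 2) - (a + b * y + c * y * (y - 1) / 2)
    = (x - y) * (b + c * (x + y - 1) / 2)"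
proof -
  \<comment> \<open>With \<open>h\<close> in place of \<open>1 / 2\<close> the identity is one of
    polynomials, valid in any characteristic.\<close>
  have "(a + b * x + c * x * (x - 1) * h) - (a + b * y + c * y * (y - 1) * h)
    = (x - y) * (b + c * (x + y - 1) * h)" for h
    by (simp add: algebra_simps)
  from this[of "inverse 2"] show ?thesis by (simp only: divide_inverse)
qed

text \<open>Here \<open>\<vartheta>\<close> at \<open>d + 1\<close> is
  \<open>(d + 1) * (y + z * d / 2)\<close>. If the second factor vanished,
  \<open>\<vartheta>\<close> would be symmetric; hence \<open>d + 1 = 0\<close> in the field.
  Smaller positive numbers are nonzero there because the eigenvalues are distinct.\<close>

lemma (in recurrent_parameters) type_II:
  assumes \<beta>: "\<beta> = 2" and two: "(2::'a) \<noteq> 0"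
  shows "type_II d \<theta> \<theta>s \<phi>"
proof -
  note form = beta_recurrent_2_form[OF _ two]
  obtain a b c where th: "\<And>i. i \<le> d \<Longrightarrow> \<theta> i = a + b * of_nat i + c * of_nat i * (of_nat i - 1) / 2"
    using form recurrent(1)[unfolded \<beta>] by metis
  obtain as bs cs where ths: "\<And>i. i \<le> d \<Longrightarrow> \<theta>s i = as + bs * of_nat i + cs * of_nat i * (of_nat i - 1) / 2"
    using form recurrent(2)[unfolded \<beta>] by metis
  obtain x y z where om: "\<And>i. i \<le> d + 1 \<Longrightarrow> \<omega> i = x + y * of_nat i + z * of_nat i * (of_nat i - 1) / 2"
    using form recurrent(3)[unfolded \<beta>] by metis
  have "x = 0" using om[of 0] omega_ends by simp
  then have om: "\<omega> i = of_nat i * (y + z * (of_nat i - 1) / 2)" if "i \<le> d + 1" for i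
    using om[OF that] by (simp add: algebra_simps)
  have diff: "\<theta> i - \<theta> j = (of_nat i - of_nat j) * (b + c * (of_nat (i + j) - 1) / 2)"
    "\<theta>s i - \<theta>s j = (of_nat i - of_nat j) * (bs + cs * (of_nat (i + j) - 1) / 2)"
    if "i \<le> d" "j \<le> d" for i j
    unfolding th[OF that(1)] th[OF that(2)] ths[OF that(1)] ths[OF that(2)] of_nat_add
    by (rule quadratic_difference)+
  have neq: "of_nat i \<noteq> (of_nat j :: 'a)" "b + c * (of_nat (i + j) - 1) / 2 \<noteq> 0"
     "bs + cs * (of_nat (i + j) - 1) / 2 \<noteq> 0"
    if "i \<le> d" "j \<le> d" "i \<noteq> j" for i j
    using diff[OF that(1,2)] theta_neq[OF that] by auto
  have nat_neq: "of_nat k \<noteq> (0::'a)" if "0 < k" "k \<le> d" for k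
    using neq(1)[of k 0] that by simp
  have bc: "2 * b \<noteq> c * (1 - of_nat m)" "2 * bs \<noteq> cs * (1 - of_nat m)"
    if "m \<in> {1..2 * d - 1}" for m
  proof -
    obtain i j where "i \<le> d" "j \<le> d" "i \<noteq> j" "i + j = m"
      using distinct_pair_with_sum \<open>m \<in> _\<close> by metis
    then have "b + c * (of_nat m - 1) / 2 \<noteq> 0" "bs + cs * (of_nat m - 1) / 2 \<noteq> 0"
      using neq(2,3)[of i j] by auto
    then show "2 * b \<noteq> c * (1 - of_nat m)" "2 * bs \<noteq> cs * (1 - of_nat m)"
      using two by (auto simp: field_simps)
  qed
  have not_symmetric: "y + z * of_nat d / 2 \<noteq> 0"
  proof
    assume "y + z * of_nat d / 2 = 0"
    then have y: "y = - z * of_nat d / 2" by (simp add: eq_neg_iff_add_eq_0)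
    \<comment> \<open>This is \<open>(1 - q ^ i) * (1 - q ^ (d - i))\<close> divided by
      \<open>(1 - q)\<^sup>2\<close> and then evaluated at \<open>q = 1\<close>.\<close>
    let ?p = "\<lambda>i. of_nat i * (of_nat d - of_nat i) :: 'a"
    let ?K = "of_nat (d - 1) * (bs + cs * (of_nat d - 1) / 2)"
    have "?K \<noteq> 0"
      using nat_neq[of "d - 1"] neq(3)[of d 0] d3 by simp
    moreover have "\<omega> (k + 1) * ?K = - z / 2 * (?p (k + 1) * (\<theta>s d - \<theta>s k) + ?p k * (\<theta>s (k + 1) - \<theta>s 0))"
      if "k < d" for k
    proof -
      define K D Z C where "K = (of_nat k :: 'a)" "D = (of_nat d :: 'a)" "Z = z / 2" "C = cs / 2"
      have "\<omega> (k + 1) = (K + 1) * Z * (K - D)"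
        using om[of "k + 1"] y that two by (simp add: K_D_Z_C_def field_simps)
      moreover have "?K = (D - 1) * (bs + C * (D - 1))"
        using d3 by (simp add: K_D_Z_C_def of_nat_diff)
      moreover have "\<theta>s d - \<theta>s k = (D - K) * (bs + C * (D + K - 1))"
        "\<theta>s (k + 1) - \<theta>s 0 = (K + 1) * (bs + C * K)"
        using diff(2)[of d k] diff(2)[of "k + 1" 0] that by (simp_all add: K_D_Z_C_def)
      moreover have "?p (k + 1) = (K + 1) * (D - K - 1)" "?p k = K * (D - K)"
        by (simp_all add: K_D_Z_C_def algebra_simps)
      moreover have "- z / 2 = - Z" by (simp add: K_D_Z_C_def)
      ultimately show ?thesis by (simp only:) (simp add: algebra_simps)
    qed
    ultimately show False
      using corner_sequence_scaled[of ?p d ?K \<omega> "- z / 2" \<theta>s] no_corner_sequence by simp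
  qed
  have "of_nat (d + 1) * (y + z * of_nat d / 2) = 0"
    using om[of "d + 1"] omega_ends by simp
  then have d1: "of_nat (d + 1) = (0::'a)" using not_symmetric by simp
  then have d: "of_nat d = (-1::'a)" by (simp add: eq_neg_iff_add_eq_0 add.commute)
  have char: "CHAR('a) = d + 1"
    by (rule CHAR_eqI[OF _ d1]) (use nat_neq in auto)
  \<comment> \<open>As \<open>d\<close> is \<open>-1\<close> in the field,
    \<open>not_symmetric\<close> reads \<open>y - z / 2 \<noteq> 0\<close>.\<close>
  have yz: "2 * y \<noteq> z" using not_symmetric two by (auto simp: d field_simps)
  have phi: "\<phi> i = of_nat i * (y + z * (of_nat i - 1) / 2)
      - (of_nat i)^2 * (b + c * (of_nat d - of_nat i) / 2) * (bs + cs * (of_nat i - 1) / 2)"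
    if i: "i \<in> {1..d}" for i
  proof -
    have le: "d + 1 - i \<le> d" using i by auto
    \<comment> \<open>In the field the reflection \<open>i \<mapsto> d + 1 - i\<close> is
      negation.\<close>
    have n: "of_nat (d + 1 - i) = (- of_nat i :: 'a)"
      using i d1 by (simp add: of_nat_diff)
    have "\<theta> (d + 1 - i) - \<theta> 0 = - of_nat i * (b + c * (of_nat d - of_nat i) / 2)"
      using diff(1)[OF le, of 0] n d by (simp add: of_nat_diff)
    moreover have "\<theta>s i - \<theta>s 0 = of_nat i * (bs + cs * (of_nat i - 1) / 2)"
      using diff(2)[of i 0] i by simp
    ultimately show ?thesis
      using i by (simp add: phi_eq om power2_eq_square)
  qed
  show ?thesis
    unfolding type_II_def
    by (rule conjI, rule char, rule exI[of _ a], rule exI[of _ b], rule exI[of _ c], rule exI[of _ as],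
        rule exI[of _ bs], rule exI[of _ cs], rule exI[of _ y], rule exI[of _ z],
        intro conjI ballI allI impI)
      (rule yz bc th ths phi phi_nonzero; assumption)+
qed

section \<open>Double root -1 outside characteristic 2\<close>

text \<open>First \<open>d\<close> is odd and then \<open>z \<noteq> 0\<close>, since each failure
  makes \<open>\<vartheta>\<close> symmetric. Now \<open>\<vartheta>\<close> at \<open>d + 1\<close>
  is \<open>z * (d + 1)\<close>, so \<open>(d + 1) div 2\<close> vanishes in the field.\<close>

lemma (in recurrent_parameters) type_III:
  assumes \<beta>: "\<beta> = -2" and two: "(2::'a) \<noteq> 0"
  shows "type_III d \<theta> \<theta>s \<phi>"
proof -
  note form = beta_recurrent_minus_2_form[OF _ two]
  obtain a b c where th: "\<And>i. i \<le> d \<Longrightarrow> \<theta> i = a + b * (-1) ^ i + c * of_nat i * (-1) ^ i"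
    using form recurrent(1)[unfolded \<beta>] by metis
  obtain as bs cs where ths: "\<And>i. i \<le> d \<Longrightarrow> \<theta>s i = as + bs * (-1) ^ i + cs * of_nat i * (-1) ^ i"
    using form recurrent(2)[unfolded \<beta>] by metis
  obtain x y z where om: "\<And>i. i \<le> d + 1 \<Longrightarrow> \<omega> i = x + y * (-1) ^ i + z * of_nat i * (-1) ^ i"
    using form recurrent(3)[unfolded \<beta>] by metis
  have "x = - y" using om[of 0] omega_ends by (simp add: eq_neg_iff_add_eq_0)
  then have om: "\<omega> i = y * ((-1) ^ i - 1) + z * of_nat i * (-1) ^ i" if "i \<le> d + 1" for i
    using om[OF that] by (simp add: algebra_simps)
  have even_diff: "\<theta> i - \<theta> 0 = c * of_nat i" "\<theta>s i - \<theta>s 0 = cs * of_nat i"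
    if "even i" "i \<le> d" for i
    using that th[of i] th[of 0] ths[of i] ths[of 0] by simp_all
  have odd_sum: "2 * b + of_nat m * c \<noteq> 0" "2 * bs + of_nat m * cs \<noteq> 0"
    if "odd m" "m \<in> {1..2 * d - 1}" for m
  proof -
    \<comment> \<open>An odd sum has summands of opposite parity. With \<open>i\<close> the even
      one, \<open>\<theta> i - \<theta> j\<close> is \<open>2 * b + m * c\<close>.\<close>
    obtain i j where ij: "i \<le> d" "j \<le> d" "i + j = m" "even i" "odd j"
    proof -
      obtain i j where ij: "i \<le> d" "j \<le> d" "i \<noteq> j" "i + j = m"
        using distinct_pair_with_sum \<open>m \<in> _\<close> by metis
      with \<open>odd m\<close> show thesis by (cases "even i") (use that[of i j] that[of j i] in auto)
    qed
    then have "i \<noteq> j" by auto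
    have "\<theta> i - \<theta> j = 2 * b + of_nat m * c" "\<theta>s i - \<theta>s j = 2 * bs + of_nat m * cs"
      using ij by (simp_all add: th ths algebra_simps flip: ij(3))
    then show "2 * b + of_nat m * c \<noteq> 0" "2 * bs + of_nat m * cs \<noteq> 0"
      using theta_neq[OF ij(1,2) \<open>i \<noteq> j\<close>] by auto
  qed
  have c: "c \<noteq> 0" "cs \<noteq> 0"
    using even_diff[of 2] theta_neq[of 2 0] d3 by auto
  \<comment> \<open>The comparison with \<open>\<theta> 0\<close> is free of \<open>b\<close> only
    at even indices, which limits \<open>k\<close> to \<open>2 * k \<le> d\<close>; this range fits
    the characteristic \<open>(d + 1) div 2\<close>.\<close>
  have nat_neq: "of_nat k \<noteq> (0::'a)" if "0 < k" "2 * k \<le> d" for k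
    using even_diff(1)[of "2 * k"] theta_neq(1)[of "2 * k" 0] that by auto
  have odd_d: "odd d"
  proof
    assume d: "even d"
    \<comment> \<open>For even \<open>d\<close> the generic product
      \<open>(1 - q ^ i) * (1 - q ^ (d - i))\<close> at \<open>q = -1\<close> is \<open>-2\<close>
      times this sequence.\<close>
    let ?p = "\<lambda>i. (-1) ^ i - 1 :: 'a"
    let ?K = "- 2 * cs"
    have y: "2 * y = - z * of_nat (d + 1)"
      using om[of "d + 1"] omega_ends d by (simp add: algebra_simps eq_neg_iff_add_eq_0)
    have "\<omega> (k + 1) * ?K = z * (?p (k + 1) * (\<theta>s d - \<theta>s k) + ?p k * (\<theta>s (k + 1) - \<theta>s 0))"
      if k: "k < d" for k
    proof (cases "even k")
      case True
      have "\<omega> (k + 1) = - (2 * y) - z * of_nat (k + 1)" using om[of "k + 1"] True k by simp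
      also have "\<dots> = z * (of_nat d - of_nat k)" unfolding y by (simp add: algebra_simps)
      finally have om_k: "\<omega> (k + 1) = z * (of_nat d - of_nat k)" .
      have "?p (k + 1) * (\<theta>s d - \<theta>s k) + ?p k * (\<theta>s (k + 1) - \<theta>s 0)
          = - 2 * cs * (of_nat d - of_nat k)"
        using True k d by (simp add: ths algebra_simps)
      then show ?thesis unfolding om_k by (simp add: mult.assoc mult.commute mult.left_commute)
    next
      case False
      then show ?thesis using om[of "k + 1"] k by (simp add: ths algebra_simps)
    qed
    then show False
      using corner_sequence_scaled[of ?p d ?K \<omega> z \<theta>s] no_corner_sequence two c d by simp
  qed
  obtain e where e: "d = 2 * e + 1" using odd_d by (elim oddE)
  then have d1: "of_nat (d - 1) \<noteq> (0::'a)" using nat_neq[of e] d3 two by simp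
  have z: "z \<noteq> 0"
  proof
    assume z: "z = 0"
    \<comment> \<open>For odd \<open>d\<close> the generic product is identically zero at
      \<open>q = -1\<close>; dividing it by \<open>2 * (1 + q)\<close> first gives this
      sequence.\<close>
    let ?p = "\<lambda>i. (if even i then of_nat i else of_nat d - of_nat i) :: 'a"
    let ?K = "- of_nat (d - 1) * (2 * bs + of_nat d * cs)"
    have "?K \<noteq> 0" using d1 odd_sum(2)[of d] odd_d d3 by simp
    moreover have "\<omega> (k + 1) * ?K = (- 2 * y) * (?p (k + 1) * (\<theta>s d - \<theta>s k) + ?p k * (\<theta>s (k + 1) - \<theta>s 0))"
      if k: "k < d" for k
    proof (cases "even k")
      case True
      have "\<omega> (k + 1) = - 2 * y" using om[of "k + 1"] True k z by simp
      moreover have "?K = ?p (k + 1) * (\<theta>s d - \<theta>s k) + ?p k * (\<theta>s (k + 1) - \<theta>s 0)"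
        using True k odd_d d3 by (simp add: ths algebra_simps of_nat_diff)
      ultimately show ?thesis by simp
    next
      case False
      then show ?thesis using om[of "k + 1"] k odd_d z by (simp add: ths algebra_simps)
    qed
    ultimately show False
      using corner_sequence_scaled[of ?p d ?K \<omega> "- 2 * y" \<theta>s] no_corner_sequence odd_d by simp
  qed
  define n where "n = (d + 1) div 2"
  have n: "d + 1 = 2 * n" "0 < n" using odd_d by (auto simp: n_def)
  have d1: "of_nat (d + 1) = (0::'a)"
    using om[of "d + 1"] omega_ends(2) odd_d z by simp
  then have n0: "of_nat n = (0::'a)" using two unfolding n(1) by simp
  have char: "CHAR('a) = n"
    by (rule CHAR_eqI[OF _ n0]) (use nat_neq n in auto)
  \<comment> \<open>\<open>d = 3\<close> would mean \<open>n = 2\<close>, which is nonzero in the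
    field.\<close>
  have "d \<noteq> 3"
    using n0 two n by auto
  then have d5: "d \<ge> 5" using odd_d d3 by (cases "d = 4") auto
  \<comment> \<open>This admits \<open>odd_sum\<close> at \<open>m = n\<close>: there
    \<open>n\<close> vanishes in the field, so \<open>2 * b \<noteq> 0\<close> and
    \<open>2 * bs \<noteq> 0\<close> remain.\<close>
  have "odd n"
  proof
    assume "even n"
    then obtain k where "n = 2 * k" by blast
    then show False using nat_neq[of k] n n0 two by auto
  qed
  then have b: "b \<noteq> 0" "bs \<noteq> 0" using odd_sum[of n] n n0 by auto
  have bc: "2 * b \<noteq> - of_nat m * c" "2 * bs \<noteq> - of_nat m * cs"
    if "m \<in> {1..2 * d - 1}" "odd m" for m
    using odd_sum[OF that(2,1)] by auto
  have phi: "\<phi> i = y * ((-1) ^ i - 1) + z * of_nat i * (-1) ^ i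
      + (b * ((-1) ^ i - 1) - c * of_nat i * (-1) ^ i)
        * (bs * ((-1) ^ i - 1) + cs * of_nat i * (-1) ^ i)" if i: "i \<in> {1..d}" for i
  proof -
    have le: "d + 1 - i \<le> d" using i by auto
    have e: "of_nat (d + 1 - i) = (- of_nat i :: 'a)"
      using i d1 by (simp add: of_nat_diff)
    have f: "(-1) ^ (d + 1 - i) = ((-1) ^ i :: 'a)"
      using i odd_d by (auto simp: minus_one_power_iff)
    have "\<theta> (d + 1 - i) - \<theta> 0 = b * ((-1) ^ i - 1) - c * of_nat i * (-1) ^ i"
      using th[OF le] th[of 0] unfolding e f by (simp add: algebra_simps)
    moreover have "\<theta>s i - \<theta>s 0 = bs * ((-1) ^ i - 1) + cs * of_nat i * (-1) ^ i"
      using i by (simp add: ths algebra_simps)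
    ultimately show ?thesis
      using i by (simp add: phi_eq om mult.commute)
  qed
  show ?thesis
    unfolding type_III_def
    by (intro conjI, rule odd_d, rule d5, rule char[unfolded n_def],
        rule exI[of _ a], rule exI[of _ b], rule exI[of _ c], rule exI[of _ as],
        rule exI[of _ bs], rule exI[of _ cs], rule exI[of _ y], rule exI[of _ z],
        intro conjI ballI allI impI)
      (rule b c z bc th ths phi phi_nonzero; assumption)+
qed

section \<open>Characteristic 2\<close>

text \<open>For \<open>\<beta> = 0\<close> the characteristic polynomial divides
  \<open>x ^ 4 - 1\<close>, so the sequences have period four; distinct eigenvalues then force
  \<open>d = 3\<close>.\<close>

lemma (in recurrent_parameters) type_IV:
  assumes \<beta>: "\<beta> = 0" and two: "(2::'a) = 0"
  shows "type_IV d \<theta> \<theta>s \<phi>"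
proof -
  have double: "x + x = 0" for x :: 'a
    using two by (metis mult_2 mult_zero_left)
  have diff: "x - y = x + y" for x y :: 'a
    by (simp only: diff_conv_add_uminus minus_unique[OF double])
  have cancel: "x + (x + y) = y" for x y :: 'a
    using double[of x] by (simp flip: add.assoc)
  have "(3::'a) = 2 + 1" by simp
  then have three: "(3::'a) = 1" unfolding two by simp
  have step: "s (k + 3) = s k - s (k + 1) + s (k + 2)"
    if "beta_recurrent \<beta> n s" "k + 3 \<le> n" for s :: "nat \<Rightarrow> 'a" and n k
    using that(1)[unfolded beta_recurrent_def \<beta>, rule_format, of "k + 2"] that(2)
    by (simp add: numeral_3_eq_3)
  have d: "d = 3"
  proof (rule ccontr)
    assume "d \<noteq> 3"
    then have "\<theta> 4 = \<theta> 0"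
      using d3 step[OF recurrent(1), of 0] step[OF recurrent(1), of 1] by (simp add: eval_nat_numeral)
    then show False using theta_neq(1)[of 4 0] d3 \<open>d \<noteq> 3\<close> by simp
  qed
  define a b c where "a = \<theta> 0" "b = \<theta> 1 - \<theta> 0" "c = \<theta> 2 - \<theta> 0"
  define as bs cs where "as = \<theta>s 0" "bs = \<theta>s 1 - \<theta>s 0" "cs = \<theta>s 2 - \<theta>s 0"
  define y z where "y = \<omega> 1" "z = \<omega> 2"
  note defs = a_b_c_def as_bs_cs_def y_z_def
  have th: "\<theta> 0 = a" "\<theta> 1 = a + b" "\<theta> 2 = a + c" "\<theta> 3 = a + b + c"
    using step[OF recurrent(1), of 0]
    by (simp_all add: defs d diff double cancel ac_simps numeral_2_eq_2)
  have ths: "\<theta>s 0 = as" "\<theta>s 1 = as + bs" "\<theta>s 2 = as + cs" "\<theta>s 3 = as + bs + cs"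
    using step[OF recurrent(2), of 0]
    by (simp_all add: defs d diff double cancel ac_simps numeral_2_eq_2)
  have om: "\<omega> 1 = y" "\<omega> 2 = z" "\<omega> 3 = y + z"
    using step[OF recurrent(3), of 0] omega_ends
    by (simp_all add: defs d diff numeral_2_eq_2)
  have bc: "b \<noteq> 0" "bs \<noteq> 0" "c \<noteq> 0" "cs \<noteq> 0" "b \<noteq> c" "bs \<noteq> cs"
    using theta_neq[of 1 0] theta_neq[of 2 0] theta_neq[of 1 2] unfolding th ths by (simp_all add: d)
  have z: "z \<noteq> 0"
  proof
    assume "z = 0"
    \<comment> \<open>For \<open>z = 0\<close> the values of \<open>\<vartheta>\<close> at
      \<open>1, 2, 3\<close> are \<open>y, 0, y\<close>. The constant \<open>K\<close> is
      \<open>bs + cs = \<theta>s 3 - \<theta>s 0\<close>.\<close>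
    let ?p = "\<lambda>i. if i = 1 \<or> i = 2 then 1 else 0 :: 'a"
    have "bs + cs \<noteq> 0" unfolding diff[symmetric] using bc by simp
    moreover have "\<omega> (k + 1) * (bs + cs)
        = y * (?p (k + 1) * (\<theta>s d - \<theta>s k) + ?p k * (\<theta>s (k + 1) - \<theta>s 0))" if "k < d" for k
    proof -
      have "k = 0 \<or> k = 1 \<or> k = 2" using that d by auto
      moreover have "\<omega> (0 + 1) = y" "\<omega> (1 + 1) = 0" "\<omega> (2 + 1) = y"
        using om \<open>z = 0\<close> by (simp_all add: numeral_2_eq_2 numeral_3_eq_3)
      moreover have "\<theta>s (0 + 1) = as + bs" "\<theta>s (1 + 1) = as + cs" "\<theta>s (2 + 1) = as + bs + cs"
        using ths by (simp_all add: numeral_2_eq_2 numeral_3_eq_3)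
      ultimately show ?thesis
        using ths by (elim disjE) (simp_all add: d diff double cancel ac_simps)
    qed
    ultimately show False
      using corner_sequence_scaled[of ?p d "bs + cs" \<omega> y \<theta>s] no_corner_sequence d by simp
  qed
  have char: "CHAR('a) = 2"
    by (rule CHAR_eqI) (auto simp: two less_2_cases_iff)
  have th': "\<theta> i = a + b * of_nat i + c * binom2 i" "\<theta>s i = as + bs * of_nat i + cs * binom2 i"
    if "i \<le> 3" for i
  proof -
    have "i = 0 \<or> i = 1 \<or> i = 2 \<or> i = 3" using that by auto
    then show "\<theta> i = a + b * of_nat i + c * binom2 i" "\<theta>s i = as + bs * of_nat i + cs * binom2 i"
      using th ths by (auto simp: binom2_def two three)
  qed
  have phi: "\<phi> i = y * of_nat i + z * binom2 i
      + (b * of_nat i + c * binom2 (i + 1)) * (bs * of_nat i + cs * binom2 i)" if "i \<in> {1..3}" for i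
  proof -
    have "i = 1 \<or> i = 2 \<or> i = 3" using that by auto
    then show ?thesis
      using om th ths phi_eq[of i]
      by (elim disjE) (simp_all add: d binom2_def two three diff double cancel ac_simps)
  qed
  show ?thesis
    unfolding type_IV_def
    by (rule conjI, rule d, rule conjI, rule char, rule exI[of _ a], rule exI[of _ b],
        rule exI[of _ c], rule exI[of _ as], rule exI[of _ bs], rule exI[of _ cs],
        rule exI[of _ y], rule exI[of _ z], intro conjI ballI allI impI)
      (rule bc z th' phi phi_nonzero[unfolded d]; assumption)+
qed

text \<open>The polynomial \<open>x\<^sup>2 - \<beta> * x + 1\<close> has a root \<open>q\<close> in
  the algebraic closure, and \<open>q\<^sup>2 = 1\<close> happens only for
  \<open>\<beta> = 2\<close> or \<open>\<beta> = -2\<close>.\<close>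

lemma (in recurrent_parameters) type_cases:
  "type_I d \<theta> \<theta>s \<phi> \<or> type_II d \<theta> \<theta>s \<phi> \<or> type_III d \<theta> \<theta>s \<phi> \<or> type_IV d \<theta> \<theta>s \<phi>"
proof -
  have "Polynomial.degree [:1, - to_ac \<beta>, 1:] > 0" by simp
  from alg_closed_imp_poly_has_root[OF this]
  obtain q where q: "q * q - to_ac \<beta> * q + 1 = 0" by (auto simp: algebra_simps)
  then have q0: "q \<noteq> 0" by auto
  have \<beta>: "to_ac \<beta> = q + inverse q"
    using q q0 by (simp add: field_simps)
  show ?thesis
  proof (cases "q\<^sup>2 = 1")
    case False
    then show ?thesis using type_I[OF q0 _ \<beta>] by blast
  next
    case True
    then have "q = 1 \<or> q = -1" by (rule power2_eq_1_iff[THEN iffD1])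
    then have "to_ac \<beta> = to_ac 2 \<or> to_ac \<beta> = to_ac (-2)" using \<beta> by auto
    then have "\<beta> = 2 \<or> \<beta> = -2" by (simp only: to_ac_eq_iff)
    \<comment> \<open>If \<open>2 = 0\<close>, both values of \<open>\<beta>\<close> are
      \<open>0\<close>, which is the case of type IV.\<close>
    then show ?thesis using type_II type_III type_IV by (cases "(2::'a) = 0") auto
  qed
qed

subsection \<open>Linear maps and bidiagonal matrices\<close>

lemma linear_map_iff:
  fixes V :: "('a::field, 'v) module" and W :: "('a, 'w) module"
  shows "linear_map class_ring V W f \<longleftrightarrow>
    vectorspace (class_ring :: 'a ring) V \<and> vectorspace (class_ring :: 'a ring) W \<and>
    (\<forall>x\<in>carrier V. f x \<in> carrier W) \<and>
    (\<forall>x\<in>carrier V. \<forall>y\<in>carrier V. f (x \<oplus>\<^bsub>V\<^esub> y) = f x \<oplus>\<^bsub>W\<^esub> f y) \<and>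
    (\<forall>c. \<forall>x\<in>carrier V. f (c \<odot>\<^bsub>V\<^esub> x) = c \<odot>\<^bsub>W\<^esub> f x)"
  unfolding linear_map_def mod_hom_def mod_hom_axioms_def LinearCombinations.module_hom_def vectorspace_def
  by (auto simp: class_ring_simps Pi_iff)

lemmas linear_mapD =
  linear_map_iff[THEN iffD1, THEN conjunct1]
  linear_map_iff[THEN iffD1, THEN conjunct2, THEN conjunct1]
  linear_map_iff[THEN iffD1, THEN conjunct2, THEN conjunct2, THEN conjunct1, rule_format]
  linear_map_iff[THEN iffD1, THEN conjunct2, THEN conjunct2, THEN conjunct2, THEN conjunct1, rule_format]
  linear_map_iff[THEN iffD1, THEN conjunct2, THEN conjunct2, THEN conjunct2, THEN conjunct2, rule_format]

lemma linear_map_comp: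
  fixes V :: "('a::field, 'v) module" and W :: "('a, 'w) module" and U :: "('a, 'u) module"
  assumes "linear_map class_ring V W f" "linear_map class_ring W U g"
  shows "linear_map class_ring V U (g \<circ> f)"
  using assms unfolding linear_map_iff by simp

lemma linear_map_scale:
  fixes V :: "('a::field, 'v) module" and W :: "('a, 'w) module"
  assumes f: "linear_map class_ring V W f"
  shows "linear_map class_ring V W (\<lambda>x. c \<odot>\<^bsub>W\<^esub> f x)"
proof -
  interpret W: vectorspace "class_ring :: 'a ring" W by (rule linear_mapD(2)[OF f])
  show ?thesis
    using f W.smult_closed W.smult_r_distr W.smult_assoc1 unfolding linear_map_iff
    by (auto simp: class_ring_simps) (metis mult.commute)
qed

lemma linear_map_inv_into:
  fixes V :: "('a::field, 'v) module" and W :: "('a, 'w) module"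
  assumes f: "linear_map class_ring V W f" and bij: "bij_betw f (carrier V) (carrier W)"
  shows "linear_map class_ring W V (inv_into (carrier V) f)"
proof -
  interpret V: vectorspace "class_ring :: 'a ring" V by (rule linear_mapD(1)[OF f])
  interpret W: vectorspace "class_ring :: 'a ring" W by (rule linear_mapD(2)[OF f])
  let ?g = "inv_into (carrier V) f"
  have g: "?g y \<in> carrier V" "f (?g y) = y" if "y \<in> carrier W" for y
    using bij that by (auto simp: bij_betw_def inv_into_into f_inv_into_f)
  have inv: "?g y = x" if "x \<in> carrier V" "f x = y" for x y
    using bij that by (auto simp: bij_betw_def)
  show ?thesis
    unfolding linear_map_iff
  proof (intro conjI ballI allI)
    fix x y assume "x \<in> carrier W" "y \<in> carrier W"
    then show "?g (x \<oplus>\<^bsub>W\<^esub> y) = ?g x \<oplus>\<^bsub>V\<^esub> ?g y"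
      by (intro inv) (simp_all add: g linear_mapD(4)[OF f])
  next
    fix c x assume "x \<in> carrier W"
    then show "?g (c \<odot>\<^bsub>W\<^esub> x) = c \<odot>\<^bsub>V\<^esub> ?g x"
      by (intro inv) (simp_all add: g linear_mapD(5)[OF f] class_ring_simps)
  qed (use g in \<open>simp_all add: V.vectorspace_axioms W.vectorspace_axioms\<close>)
qed

text \<open>The vectors on which \<open>f\<close> and \<open>g\<close> agree form a submodule that
  contains \<open>S\<close>.\<close>

lemma linear_maps_eq_on_span:
  fixes V :: "('a::field, 'v) module" and W :: "('a, 'w) module"
  assumes f: "linear_map class_ring V W f" and g: "linear_map class_ring V W g"
    and S: "LinearCombinations.module.span (class_ring :: 'a ring) V S = carrier V" "S \<subseteq> carrier V"
    and eq: "\<And>s. s \<in> S \<Longrightarrow> f s = g s" and x: "x \<in> carrier V"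
  shows "f x = g x"
proof -
  interpret V: vectorspace "class_ring :: 'a ring" V by (rule linear_mapD(1)[OF f])
  interpret W: vectorspace "class_ring :: 'a ring" W by (rule linear_mapD(2)[OF f])
  let ?N = "{x \<in> carrier V. f x = g x}"
  have zero: "h \<zero>\<^bsub>V\<^esub> = \<zero>\<^bsub>W\<^esub>" if "linear_map class_ring V W h" for h
    using linear_mapD(5)[OF that, of "\<zero>\<^bsub>V\<^esub>" 0] linear_mapD(3)[OF that]
      V.lmult_0[of "\<zero>\<^bsub>V\<^esub>"] W.lmult_0[of "h \<zero>\<^bsub>V\<^esub>"]
    by (simp add: class_ring_simps)
  have "submodule class_ring ?N V"
    by unfold_locales
      (auto simp: zero[OF f] zero[OF g] linear_mapD(4,5)[OF f] linear_mapD(4,5)[OF g] class_ring_simps)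
  then have "V.span S \<subseteq> ?N"
    by (intro V.span_is_subset) (use S eq in auto)
  then show ?thesis using S x by auto
qed

lemma basis_spans:
  fixes V :: "('a::field, 'v) module"
  assumes "vectorspace (class_ring :: 'a ring) V" "vectorspace.basis (class_ring :: 'a ring) V S"
  shows "LinearCombinations.module.span (class_ring :: 'a ring) V S = carrier V" "S \<subseteq> carrier V"
  using assms by (auto simp: vectorspace.basis_def)

lemma linear_map_mult_mat_vec:
  fixes M :: "'a::field mat"
  assumes "M \<in> carrier_mat n n"
  shows "linear_map class_ring (module_vec TYPE('a) n) (module_vec TYPE('a) n) ((*\<^sub>v) M)"
  unfolding linear_map_iff
  using vec_vs[of n] assms by (auto simp: module_vec_simps mult_add_distrib_mat_vec mult_mat_vec)

section \<open>Coordinates with respect to an ordered basis\<close>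

text \<open>This direction has an explicit formula; the coordinate map itself is later taken as its
  inverse.\<close>

definition from_coords :: "nat \<Rightarrow> ('a::field, 'v) module \<Rightarrow> (nat \<Rightarrow> 'v) \<Rightarrow> 'a vec \<Rightarrow> 'v" where
  "from_coords d V v x = (\<Oplus>\<^bsub>V\<^esub>i\<in>{0..d}. (x $ i) \<odot>\<^bsub>V\<^esub> v i)"

context
  fixes d :: nat and V :: "('a::field, 'v) module" and v :: "nat \<Rightarrow> 'v"
  assumes V: "vectorspace (class_ring :: 'a ring) V" and v: "ordered_basis d V v"
begin

interpretation V: vectorspace "class_ring :: 'a ring" V by (rule V)

lemma basis_carrier: "i \<le> d \<Longrightarrow> v i \<in> carrier V"
  using v unfolding ordered_basis_def V.basis_def by auto

lemma linear_map_from_coords: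
  "linear_map class_ring (module_vec TYPE('a) (d + 1)) V (from_coords d V v)"
  unfolding linear_map_iff
proof (intro conjI ballI allI)
  show "vectorspace class_ring (module_vec TYPE('a) (d + 1))" by (rule vec_vs)
  fix x :: "'a vec" assume x: "x \<in> carrier (module_vec TYPE('a) (d + 1))"
  then have x': "x \<in> carrier_vec (d + 1)" by (simp add: module_vec_simps)
  show "from_coords d V v x \<in> carrier V"
    unfolding from_coords_def by (intro V.finsum_closed) (auto simp: basis_carrier class_ring_simps)
  show "from_coords d V v (x \<oplus>\<^bsub>module_vec TYPE('a) (d + 1)\<^esub> y) =
      from_coords d V v x \<oplus>\<^bsub>V\<^esub> from_coords d V v y"
    if "y \<in> carrier (module_vec TYPE('a) (d + 1))" for y
  proof -
    have y': "y \<in> carrier_vec (d + 1)" using that by (simp add: module_vec_simps)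
    have "from_coords d V v (x + y) = (\<Oplus>\<^bsub>V\<^esub>i\<in>{0..d}. (x $ i) \<odot>\<^bsub>V\<^esub> v i \<oplus>\<^bsub>V\<^esub> (y $ i) \<odot>\<^bsub>V\<^esub> v i)"
      unfolding from_coords_def
    proof (rule V.finsum_cong')
      fix i assume i: "i \<in> {0..d}"
      then have "((x $ i) \<oplus>\<^bsub>class_ring\<^esub> (y $ i)) \<odot>\<^bsub>V\<^esub> v i = (x $ i) \<odot>\<^bsub>V\<^esub> v i \<oplus>\<^bsub>V\<^esub> (y $ i) \<odot>\<^bsub>V\<^esub> v i"
        by (intro V.smult_l_distr) (auto simp: class_ring_simps basis_carrier)
      then show "((x + y) $ i) \<odot>\<^bsub>V\<^esub> v i = (x $ i) \<odot>\<^bsub>V\<^esub> v i \<oplus>\<^bsub>V\<^esub> (y $ i) \<odot>\<^bsub>V\<^esub> v i"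
        using i x' y' by (simp add: class_ring_simps)
    qed (auto simp: basis_carrier class_ring_simps)
    also have "\<dots> = from_coords d V v x \<oplus>\<^bsub>V\<^esub> from_coords d V v y"
      unfolding from_coords_def by (rule V.finsum_addf) (auto simp: basis_carrier class_ring_simps)
    finally show ?thesis by (simp add: module_vec_simps)
  qed
  show "from_coords d V v (c \<odot>\<^bsub>module_vec TYPE('a) (d + 1)\<^esub> x) = c \<odot>\<^bsub>V\<^esub> from_coords d V v x" for c
  proof -
    have "c \<odot>\<^bsub>V\<^esub> from_coords d V v x = (\<Oplus>\<^bsub>V\<^esub>i\<in>{0..d}. c \<odot>\<^bsub>V\<^esub> ((x $ i) \<odot>\<^bsub>V\<^esub> v i))"
      unfolding from_coords_def by (rule V.finsum_smult) (auto simp: basis_carrier class_ring_simps)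
    also have "\<dots> = from_coords d V v (c \<cdot>\<^sub>v x)"
      unfolding from_coords_def
    proof (rule V.finsum_cong')
      fix i assume i: "i \<in> {0..d}"
      then have "(c \<otimes>\<^bsub>class_ring\<^esub> (x $ i)) \<odot>\<^bsub>V\<^esub> v i = c \<odot>\<^bsub>V\<^esub> ((x $ i) \<odot>\<^bsub>V\<^esub> v i)"
        by (intro V.smult_assoc1) (auto simp: class_ring_simps basis_carrier)
      then show "c \<odot>\<^bsub>V\<^esub> ((x $ i) \<odot>\<^bsub>V\<^esub> v i) = ((c \<cdot>\<^sub>v x) $ i) \<odot>\<^bsub>V\<^esub> v i"
        using i x' by (simp add: class_ring_simps)
    qed (auto simp: basis_carrier class_ring_simps)
    finally show ?thesis by (simp add: module_vec_simps)
  qed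
qed (rule V)

lemma from_coords_unit_vec:
  assumes "j \<le> d"
  shows "from_coords d V v (unit_vec (d + 1) j) = v j"
proof -
  have "from_coords d V v (unit_vec (d + 1) j) = (\<Oplus>\<^bsub>V\<^esub>i\<in>{0..d}. if j = i then v i else \<zero>\<^bsub>V\<^esub>)"
    unfolding from_coords_def
    by (rule V.finsum_cong')
      (use assms basis_carrier V.lmult_0 V.smult_one in \<open>auto simp: unit_vec_def class_ring_simps\<close>)
  also have "\<dots> = v j"
    using V.add.finprod_singleton[of j "{0..d}" v] assms basis_carrier by (auto simp: finsum_def)
  finally show ?thesis .
qed

text \<open>Linear independence of the basis gives a trivial kernel, and spanning gives
  surjectivity.\<close>

lemma bij_from_coords:
  "bij_betw (from_coords d V v) (carrier (module_vec TYPE('a) (d + 1))) (carrier V)"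
proof -
  let ?W = "module_vec TYPE('a) (d + 1)"
  interpret T: linear_map "class_ring :: 'a ring" ?W V "from_coords d V v"
    by (rule linear_map_from_coords)
  have inj_v: "inj_on v {0..d}" using v by (simp add: ordered_basis_def)
  have ker: "x = \<zero>\<^bsub>?W\<^esub>" if x: "x \<in> carrier ?W" and zero: "from_coords d V v x = \<zero>\<^bsub>V\<^esub>" for x
  proof -
    \<comment> \<open>\<open>lincomb\<close> runs over the set of basis vectors, so the coordinates
      are reindexed along the injective \<open>v\<close>.\<close>
    let ?a = "\<lambda>w. x $ the_inv_into {0..d} v w"
    have a: "?a (v i) = x $ i" if "i \<le> d" for i
      using that by (simp add: the_inv_into_f_f[OF inj_v])
    have "V.lincomb ?a (v ` {0..d}) = (\<Oplus>\<^bsub>V\<^esub>i\<in>{0..d}. ?a (v i) \<odot>\<^bsub>V\<^esub> v i)"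
      unfolding V.lincomb_def
      by (rule V.finsum_reindex[OF _ inj_v]) (auto simp: basis_carrier class_ring_simps)
    also have "\<dots> = from_coords d V v x"
      unfolding from_coords_def
      by (rule V.finsum_cong') (auto simp: a basis_carrier class_ring_simps)
    finally have lincomb: "V.lincomb ?a (v ` {0..d}) = \<zero>\<^bsub>V\<^esub>" using zero by simp
    have "\<not> V.lin_dep (v ` {0..d})" using v by (simp add: ordered_basis_def V.basis_def)
    then have "?a w = 0" if "w \<in> v ` {0..d}" for w
      using lincomb that unfolding V.lin_dep_def by (auto simp: class_ring_simps)
    then have "x $ i = 0" if "i \<le> d" for i using a that by auto
    then show ?thesis using x by (intro eq_vecI) (auto simp: module_vec_simps)
  qed
  have zero: "\<zero>\<^bsub>?W\<^esub> \<in> carrier ?W" by (simp add: module_vec_simps)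
  have "{x \<in> carrier ?W. from_coords d V v x = \<zero>\<^bsub>V\<^esub>} = {\<zero>\<^bsub>?W\<^esub>}"
    using ker T.f0_is_0 zero by blast
  then have "carrier (?W\<lparr>carrier := mod_hom.ker ?W V (from_coords d V v)\<rparr>) = {\<zero>\<^bsub>?W\<^esub>}"
    unfolding mod_hom.ker_def[OF linear_map.axioms(3)[OF linear_map_from_coords]] by simp
  then have "inj_on (from_coords d V v) (carrier ?W)"
    by (rule T.Ke0_imp_inj)
  moreover have "from_coords d V v ` carrier ?W = carrier V"
  proof
    have "V.span (v ` {0..d}) \<subseteq> T.im"
    proof (rule V.span_is_subset[OF _ T.im_is_submodule])
      show "v ` {0..d} \<subseteq> T.im"
      proof
        fix w assume "w \<in> v ` {0..d}"
        then obtain j where "j \<le> d" "w = v j" by auto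
        then have "w = from_coords d V v (unit_vec (d + 1) j)"
          using from_coords_unit_vec by metis
        moreover have "unit_vec (d + 1) j \<in> carrier ?W" by (simp add: module_vec_simps)
        ultimately show "w \<in> T.im" unfolding T.im_def by (rule image_eqI)
      qed
    qed
    then show "carrier V \<subseteq> from_coords d V v ` carrier ?W"
      using v unfolding T.im_def by (simp add: ordered_basis_def V.basis_def)
  qed (auto simp: T.f_im)
  ultimately show ?thesis by (simp add: bij_betw_def)
qed

text \<open>Both sides are linear in \<open>x\<close>, and at the unit vector with index
  \<open>j\<close> both equal \<open>B (v j)\<close>.\<close>

lemma from_coords_mult_mat_vec:
  assumes B: "endomorphism V B" and M: "represents d V v M B" "M \<in> carrier_mat (d + 1) (d + 1)"
    and x: "x \<in> carrier_vec (d + 1)"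
  shows "from_coords d V v (M *\<^sub>v x) = B (from_coords d V v x)"
proof -
  have unit: "LinearCombinations.module.span (class_ring :: 'a ring) (module_vec TYPE('a) (d + 1))
      (set (unit_vecs (d + 1))) = carrier (module_vec TYPE('a) (d + 1))"
    using vec_space.span_unit_vecs_is_carrier by (simp add: module_vec_simps)
  have "(from_coords d V v \<circ> (*\<^sub>v) M) x = (B \<circ> from_coords d V v) x"
  proof (rule linear_maps_eq_on_span[OF linear_map_comp linear_map_comp unit])
    fix s :: "'a vec" assume "s \<in> set (unit_vecs (d + 1))"
    then obtain j where j: "j \<le> d" "s = unit_vec (d + 1) j" by (auto simp: unit_vecs_def)
    have "from_coords d V v (M *\<^sub>v s) = from_coords d V v (col M j)"
      using j M(2) by (intro arg_cong[of _ _ "from_coords d V v"] eq_vecI) (auto simp: scalar_prod_right_unit)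
    also have "\<dots> = B (v j)"
      using M j unfolding represents_def from_coords_def
      by (auto intro!: V.finsum_cong' simp: basis_carrier class_ring_simps)
    finally show "(from_coords d V v \<circ> (*\<^sub>v) M) s = (B \<circ> from_coords d V v) s"
      using j from_coords_unit_vec[OF j(1)] by simp
  qed (use x B M linear_map_from_coords linear_map_mult_mat_vec in \<open>auto simp: unit_vecs_def module_vec_simps\<close>)
  then show ?thesis by simp
qed

end

section \<open>Bidiagonal matrices acting on vectors\<close>

lemma lower_bidiag_mult_vec:
  assumes "x \<in> carrier_vec (d + 1)" "i \<le> d"
  shows "(lower_bidiag d \<theta> *\<^sub>v x) $ i = \<theta> (d - i) * x $ i + (if i = 0 then 0 else x $ (i - 1))"
proof -
  have "(lower_bidiag d \<theta> *\<^sub>v x) $ i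
    = (\<Sum>j = 0..<d + 1. (if i = j then \<theta> (d - i) else if i = j + 1 then 1 else 0) * x $ j)"
    using assms by (simp add: lower_bidiag_def scalar_prod_def)
  \<comment> \<open>For \<open>i = 0\<close> the index \<open>i - 1\<close> is again
    \<open>0\<close>, and the inner conditional makes the second sum vanish.\<close>
  also have "\<dots> = (\<Sum>j = 0..<d + 1. if j = i then \<theta> (d - i) * x $ i else 0)
      + (\<Sum>j = 0..<d + 1. if j = i - 1 then (if i = 0 then 0 else x $ (i - 1)) else 0)"
    unfolding sum.distrib[symmetric] by (rule sum.cong) auto
  also have "\<dots> = \<theta> (d - i) * x $ i + (if i = 0 then 0 else x $ (i - 1))"
    using assms(2) by (subst (1 2) sum.delta) auto
  finally show ?thesis .
qed

lemma upper_bidiag_mult_vec: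
  assumes "x \<in> carrier_vec (d + 1)" "i \<le> d"
  shows "(upper_bidiag d \<theta>s \<phi> *\<^sub>v x) $ i
    = \<theta>s i * x $ i + (if i = d then 0 else \<phi> (i + 1) * x $ (i + 1))"
proof -
  have "(upper_bidiag d \<theta>s \<phi> *\<^sub>v x) $ i
    = (\<Sum>j = 0..<d + 1. (if i = j then \<theta>s i else if j = i + 1 then \<phi> j else 0) * x $ j)"
    using assms by (simp add: upper_bidiag_def scalar_prod_def)
  also have "\<dots> = (\<Sum>j = 0..<d + 1. if j = i then \<theta>s i * x $ i else 0)
      + (\<Sum>j = 0..<d + 1. if j = i + 1 then \<phi> (i + 1) * x $ (i + 1) else 0)"
    unfolding sum.distrib[symmetric] by (rule sum.cong) auto
  also have "\<dots> = \<theta>s i * x $ i + (if i = d then 0 else \<phi> (i + 1) * x $ (i + 1))"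
    using assms(2) by (subst (1 2) sum.delta) auto
  finally show ?thesis .
qed

lemma bidiag_carrier:
  "lower_bidiag d \<theta> \<in> carrier_mat (d + 1) (d + 1)"
  "upper_bidiag d \<theta>s \<phi> \<in> carrier_mat (d + 1) (d + 1)"
  by (simp_all add: lower_bidiag_def upper_bidiag_def)

section \<open>Primitive idempotents and eigenvalues\<close>

lemma linear_map_zero:
  fixes V :: "('a::field, 'v) module" and W :: "('a, 'w) module"
  assumes "linear_map class_ring V W f"
  shows "f \<zero>\<^bsub>V\<^esub> = \<zero>\<^bsub>W\<^esub>"
  using mod_hom.f0_is_0[OF linear_map.axioms(3)[OF assms]] .

lemma smult_zero:
  fixes V :: "('a::field, 'v) module"
  assumes "vectorspace (class_ring :: 'a ring) V"
  shows "c \<odot>\<^bsub>V\<^esub> \<zero>\<^bsub>V\<^esub> = \<zero>\<^bsub>V\<^esub>"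
proof -
  interpret V: vectorspace "class_ring :: 'a ring" V by (rule assms)
  show ?thesis by (rule V.smult_r_null) (simp add: class_ring_simps)
qed

text \<open>On a basis of eigenvectors \<open>E\<close> acts as \<open>1\<close> or
  \<open>0\<close>; both equations hold there and extend by linearity.\<close>

lemma primitive_idempotent_eigenvector:
  fixes V :: "('a::field, 'v) module"
  assumes B: "endomorphism V B" and diag: "diagonalizable_map V B"
    and E: "primitive_idempotent V B t E" and x: "x \<in> carrier V"
  shows "B (E x) = t \<odot>\<^bsub>V\<^esub> E x" "E (B x) = t \<odot>\<^bsub>V\<^esub> E x"
proof -
  note V = linear_mapD(1)[OF B]
  have lin: "endomorphism V E" using E by (simp add: primitive_idempotent_def)
  obtain S where S: "vectorspace.basis (class_ring :: 'a ring) V S"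
    and eig: "\<And>s. s \<in> S \<Longrightarrow> \<exists>u. s \<in> eigen_space V B u"
    using diag unfolding diagonalizable_map_def by blast
  note span = basis_spans[OF V S]
  have on_S: "B (E s) = t \<odot>\<^bsub>V\<^esub> E s \<and> E (B s) = t \<odot>\<^bsub>V\<^esub> E s" if s: "s \<in> S" for s
  proof -
    obtain u where u: "s \<in> eigen_space V B u" using eig[OF s] by blast
    then have Bs: "B s = u \<odot>\<^bsub>V\<^esub> s" and sV: "s \<in> carrier V" by (simp_all add: eigen_space_def)
    have "E s = (if u = t then s else \<zero>\<^bsub>V\<^esub>)" using E u by (auto simp: primitive_idempotent_def)
    then show ?thesis
      using linear_mapD(5)[OF lin sV] linear_map_zero[OF B] smult_zero[OF V]
      by (simp add: Bs)
  qed
  note agree = linear_maps_eq_on_span[OF _ linear_map_scale[OF lin, of t] span _ x]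
  show "B (E x) = t \<odot>\<^bsub>V\<^esub> E x"
    using agree[OF linear_map_comp[OF lin B]] on_S by simp
  show "E (B x) = t \<odot>\<^bsub>V\<^esub> E x"
    using agree[OF linear_map_comp[OF B lin]] on_S by simp
qed

text \<open>The ordering only provides some injective \<open>\<theta>'\<close>. It agrees with
  \<open>\<theta>\<close>, since \<open>E i\<close> fixes a nonzero eigenvector for
  \<open>\<theta> i\<close> and would annihilate it if \<open>\<theta>' i\<close> were
  different.\<close>

lemma eigen_value_ordering_inj:
  fixes V :: "('a::field, 'v) module"
  assumes ord: "idempotent_ordering d V B E"
    and \<theta>: "\<And>i. i \<le> d \<Longrightarrow> primitive_idempotent V B (\<theta> i) (E i)"
  shows "inj_on \<theta> {0..d}"
proof -
  obtain \<theta>' where inj: "inj_on \<theta>' {0..d}"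
    and \<theta>': "\<And>i. i \<le> d \<Longrightarrow> primitive_idempotent V B (\<theta>' i) (E i)"
    using ord unfolding idempotent_ordering_def bij_betw_def by blast
  have "\<theta> i = \<theta>' i" if i: "i \<le> d" for i
  proof (rule ccontr)
    assume "\<theta> i \<noteq> \<theta>' i"
    moreover obtain w where "w \<in> eigen_space V B (\<theta> i)" "w \<noteq> \<zero>\<^bsub>V\<^esub>"
      using \<theta>[OF i] unfolding primitive_idempotent_def eigen_value_def by blast
    ultimately show False using \<theta>[OF i] \<theta>'[OF i] unfolding primitive_idempotent_def by metis
  qed
  with inj show ?thesis by (auto simp: inj_on_def)
qed

text \<open>
  If \<open>x\<close> is a \<open>\<theta>\<^sup>*\<^sub>d\<close>-eigenvector of the upper bidiagonal matrix \<open>U\<close>, a corner sequence \<open>r\<close>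
  solves \<open>(L - \<theta>\<^sub>0) x = (U - \<theta>\<^sup>*\<^sub>0) t\<close> explicitly for \<open>t\<close>.
\<close>

lemma bidiag_corner_solution:
  fixes \<theta> \<theta>s \<phi> r :: "nat \<Rightarrow> 'a::field"
  assumes r: "corner_sequence d \<theta>s (vartheta d \<theta> \<theta>s \<phi>) r"
    and \<phi>: "\<And>i. i \<in> {1..d} \<Longrightarrow> \<phi> i \<noteq> 0"
    and x: "x \<in> carrier_vec (d + 1)" "upper_bidiag d \<theta>s \<phi> *\<^sub>v x = \<theta>s d \<cdot>\<^sub>v x"
  shows "\<exists>t \<in> carrier_vec (d + 1). lower_bidiag d \<theta> *\<^sub>v x + \<theta>s 0 \<cdot>\<^sub>v t
    = upper_bidiag d \<theta>s \<phi> *\<^sub>v t + \<theta> 0 \<cdot>\<^sub>v x"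
proof
  \<comment> \<open>Row \<open>i\<close> of the system is split by the ansatz \<open>\<phi> (i + 1)
    * t $ (i + 1) = x $ i * (\<theta> (d - i) - \<theta> 0 + r i)\<close>. The entry at
    \<open>0\<close> is free, because its coefficient is
    \<open>\<theta>s 0 - \<theta>s 0\<close>.\<close>
  define t where "t = vec (d + 1)
    (\<lambda>i. if i = 0 then 0 else x $ (i - 1) * (\<theta> (d - (i - 1)) - \<theta> 0 + r (i - 1)) / \<phi> i)"
  show t: "t \<in> carrier_vec (d + 1)" by (simp add: t_def)
  have t_0: "t $ 0 = 0" by (simp add: t_def)
  have t_Suc: "\<phi> (k + 1) * t $ (k + 1) = x $ k * (\<theta> (d - k) - \<theta> 0 + r k)" if "k < d" for k
    using that \<phi>[of "k + 1"] by (simp add: t_def)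
  have x_Suc: "\<phi> (k + 1) * x $ (k + 1) = (\<theta>s d - \<theta>s k) * x $ k" if "k < d" for k
    using upper_bidiag_mult_vec[OF x(1), of k \<theta>s \<phi>] x that by (simp add: algebra_simps)
  show "lower_bidiag d \<theta> *\<^sub>v x + \<theta>s 0 \<cdot>\<^sub>v t = upper_bidiag d \<theta>s \<phi> *\<^sub>v t + \<theta> 0 \<cdot>\<^sub>v x"
  proof (rule eq_vecI)
    fix i assume "i < dim_vec (upper_bidiag d \<theta>s \<phi> *\<^sub>v t + \<theta> 0 \<cdot>\<^sub>v x)"
    then have i: "i \<le> d" using x by simp
    \<comment> \<open>In the last row, \<open>i = d\<close>, this is \<open>r d = 0\<close>.\<close>
    have up: "(if i = d then 0 else \<phi> (i + 1) * t $ (i + 1)) = x $ i * (\<theta> (d - i) - \<theta> 0 + r i)"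
      using t_Suc[of i] i r by (simp add: corner_sequence_def)
    \<comment> \<open>The rest of row \<open>i\<close>. Row \<open>0\<close> needs
      \<open>r 0 = 0\<close>; row \<open>k + 1\<close>, multiplied by \<open>\<phi> (k + 1)\<close>,
      is the equation of a corner sequence.\<close>
    have low: "(if i = 0 then 0 else x $ (i - 1)) = (\<theta>s i - \<theta>s 0) * t $ i + x $ i * r i"
    proof (cases i)
      case 0
      then show ?thesis using t_0 r by (simp add: corner_sequence_def)
    next
      case (Suc k)
      then have k: "k < d" using i by simp
      have "\<phi> (k + 1) = vartheta d \<theta> \<theta>s \<phi> (k + 1) + (\<theta>s (k + 1) - \<theta>s 0) * (\<theta> (d - k) - \<theta> 0)"
        using k by (simp add: vartheta_def Suc_diff_Suc)
      moreover have "vartheta d \<theta> \<theta>s \<phi> (k + 1) = r (k + 1) * (\<theta>s d - \<theta>s k) + r k * (\<theta>s (k + 1) - \<theta>s 0)"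
        using r k by (simp add: corner_sequence_def)
      ultimately have "\<phi> (k + 1) * x $ k
          = (\<theta>s (k + 1) - \<theta>s 0) * (x $ k * (\<theta> (d - k) - \<theta> 0 + r k)) + (\<theta>s d - \<theta>s k) * x $ k * r (k + 1)"
        by (simp only:) (simp add: algebra_simps)
      also have "\<dots> = \<phi> (k + 1) * ((\<theta>s (k + 1) - \<theta>s 0) * t $ (k + 1) + x $ (k + 1) * r (k + 1))"
        unfolding t_Suc[OF k, symmetric] x_Suc[OF k, symmetric] by (simp add: algebra_simps)
      finally show ?thesis using \<phi>[of "k + 1"] k Suc by simp
    qed
    have "(lower_bidiag d \<theta> *\<^sub>v x + \<theta>s 0 \<cdot>\<^sub>v t) $ i
      = \<theta> (d - i) * x $ i + (if i = 0 then 0 else x $ (i - 1)) + \<theta>s 0 * t $ i"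
      using i x(1) t lower_bidiag_mult_vec[OF x(1) i, of \<theta>] bidiag_carrier(1)[of d \<theta>] by simp
    also have "\<dots> = \<theta>s i * t $ i + (if i = d then 0 else \<phi> (i + 1) * t $ (i + 1)) + \<theta> 0 * x $ i"
      unfolding up low by (simp add: algebra_simps)
    also have "\<dots> = (upper_bidiag d \<theta>s \<phi> *\<^sub>v t + \<theta> 0 \<cdot>\<^sub>v x) $ i"
      using i x(1) t upper_bidiag_mult_vec[OF t i, of \<theta>s \<phi>] bidiag_carrier(2)[of d \<theta>s \<phi>] by simp
    finally show "(lower_bidiag d \<theta> *\<^sub>v x + \<theta>s 0 \<cdot>\<^sub>v t) $ i
      = (upper_bidiag d \<theta>s \<phi> *\<^sub>v t + \<theta> 0 \<cdot>\<^sub>v x) $ i" .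
  qed (use x t bidiag_carrier in simp)
qed

text \<open>For \<open>w\<close> in \<open>V\<close> the preceding solution gives
  \<open>(A - \<theta> 0) (E' w) = (As - \<theta>s 0) t\<close> for some \<open>t\<close>. Applying
  \<open>E\<close> kills the right side, since \<open>E\<close> absorbs \<open>As\<close> into the
  factor \<open>\<theta>s 0\<close>, and it kills \<open>E' w\<close> because
  \<open>\<theta>s d \<noteq> \<theta>s 0\<close>.\<close>

lemma corner_sequence_imp_zero_map:
  fixes V :: "('a::field, 'v) module"
  assumes A: "endomorphism V A" and As: "endomorphism V As" "diagonalizable_map V As"
    and E: "primitive_idempotent V As (\<theta>s 0) E" "primitive_idempotent V As (\<theta>s d) E'"
    and neq: "\<theta>s d \<noteq> \<theta>s 0"
    and v: "ordered_basis d V v" "represents d V v (lower_bidiag d \<theta>) A"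
      "represents d V v (upper_bidiag d \<theta>s \<phi>) As"
    and \<phi>: "\<And>i. i \<in> {1..d} \<Longrightarrow> \<phi> i \<noteq> 0"
    and r: "corner_sequence d \<theta>s (vartheta d \<theta> \<theta>s \<phi>) r"
  shows "zero_map V (E \<circ> A \<circ> E')"
  unfolding zero_map_def
proof
  let ?W = "module_vec TYPE('a) (d + 1)" and ?\<tau> = "from_coords d V v"
  let ?L = "lower_bidiag d \<theta>" and ?U = "upper_bidiag d \<theta>s \<phi>"
  fix w assume w: "w \<in> carrier V"
  note V = linear_mapD(1)[OF A]
  interpret V: vectorspace "class_ring :: 'a ring" V by (rule V)
  have linE: "endomorphism V E" "endomorphism V E'" using E by (simp_all add: primitive_idempotent_def)
  note lin\<tau> = linear_map_from_coords[OF V v(1)] and bij = bij_from_coords[OF V v(1)]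
  note mult_L = from_coords_mult_mat_vec[OF V v(1) A v(2) bidiag_carrier(1)]
  note mult_U = from_coords_mult_mat_vec[OF V v(1) As(1) v(3) bidiag_carrier(2)]
  have E'w: "E' w \<in> carrier V" using linE(2) w by (rule linear_mapD(3))
  have eig: "As (E' w) = \<theta>s d \<odot>\<^bsub>V\<^esub> E' w"
    by (rule primitive_idempotent_eigenvector(1)[OF As E(2) w])
  then have "E' w \<in> eigen_space V As (\<theta>s d)" using E'w by (simp add: eigen_space_def)
  then have E0: "E (E' w) = \<zero>\<^bsub>V\<^esub>" using E(1) neq by (simp add: primitive_idempotent_def)
  have "E' w \<in> ?\<tau> ` carrier_vec (d + 1)"
    using bij E'w unfolding bij_betw_def module_vec_simps by simp
  then obtain x where E'w_eq: "E' w = ?\<tau> x" and x: "x \<in> carrier_vec (d + 1)" by (rule imageE)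
  note \<tau>x = E'w_eq[symmetric]
  have scale: "?\<tau> (c \<cdot>\<^sub>v y) = c \<odot>\<^bsub>V\<^esub> ?\<tau> y" if "y \<in> carrier_vec (d + 1)" for c y
    using linear_mapD(5)[OF lin\<tau>, of y c] that by (simp add: module_vec_simps)
  have add: "?\<tau> (y + z) = ?\<tau> y \<oplus>\<^bsub>V\<^esub> ?\<tau> z" if "y \<in> carrier_vec (d + 1)" "z \<in> carrier_vec (d + 1)" for y z
    using linear_mapD(4)[OF lin\<tau>, of y z] that by (simp add: module_vec_simps)
  have "?\<tau> (?U *\<^sub>v x) = ?\<tau> (\<theta>s d \<cdot>\<^sub>v x)"
    using mult_U[OF x] scale[OF x] eig by (simp add: \<tau>x)
  moreover have "?U *\<^sub>v x \<in> carrier ?W" "\<theta>s d \<cdot>\<^sub>v x \<in> carrier ?W"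
    using x bidiag_carrier(2)[of d \<theta>s \<phi>] by (simp_all add: module_vec_simps)
  ultimately have "?U *\<^sub>v x = \<theta>s d \<cdot>\<^sub>v x"
    by (rule inj_onD[OF bij_betw_imp_inj_on[OF bij]])
  from bidiag_corner_solution[OF r \<phi> x this]
  obtain t where eq: "?L *\<^sub>v x + \<theta>s 0 \<cdot>\<^sub>v t = ?U *\<^sub>v t + \<theta> 0 \<cdot>\<^sub>v x"
    and t: "t \<in> carrier_vec (d + 1)"
    by (rule bexE)
  let ?t = "?\<tau> t"
  have tV: "?t \<in> carrier V" using linear_mapD(3)[OF lin\<tau>, of t] t by (simp add: module_vec_simps)
  have Lx: "?L *\<^sub>v x \<in> carrier_vec (d + 1)" "?U *\<^sub>v t \<in> carrier_vec (d + 1)"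
    by (rule mult_mat_vec_carrier[OF bidiag_carrier(1) x], rule mult_mat_vec_carrier[OF bidiag_carrier(2) t])
  have "A (E' w) \<oplus>\<^bsub>V\<^esub> \<theta>s 0 \<odot>\<^bsub>V\<^esub> ?t = As ?t \<oplus>\<^bsub>V\<^esub> \<theta> 0 \<odot>\<^bsub>V\<^esub> E' w"
    using arg_cong[OF eq, of ?\<tau>] x t Lx
    by (simp add: add scale mult_L mult_U \<tau>x)
  then have "E (A (E' w) \<oplus>\<^bsub>V\<^esub> \<theta>s 0 \<odot>\<^bsub>V\<^esub> ?t) = E (As ?t \<oplus>\<^bsub>V\<^esub> \<theta> 0 \<odot>\<^bsub>V\<^esub> E' w)"
    by simp
  moreover have mem: "A (E' w) \<in> carrier V" "As ?t \<in> carrier V" "c \<odot>\<^bsub>V\<^esub> ?t \<in> carrier V"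
    "c \<odot>\<^bsub>V\<^esub> E' w \<in> carrier V" "E ?t \<in> carrier V" "c \<odot>\<^bsub>V\<^esub> E ?t \<in> carrier V" "E (A (E' w)) \<in> carrier V" for c
    using E'w tV linear_mapD(3)[OF A] linear_mapD(3)[OF As(1)] linear_mapD(3)[OF linE(1)] V.smult_closed
    by (auto simp: class_ring_simps)
  ultimately have "E (A (E' w)) \<oplus>\<^bsub>V\<^esub> \<theta>s 0 \<odot>\<^bsub>V\<^esub> E ?t = \<theta>s 0 \<odot>\<^bsub>V\<^esub> E ?t"
    using primitive_idempotent_eigenvector(2)[OF As E(1) tV] E0 smult_zero[OF V] E'w tV
    by (simp add: linear_mapD(4,5)[OF linE(1)])
  then show "(E \<circ> A \<circ> E') w = \<zero>\<^bsub>V\<^esub>"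
    using mem V.add.r_cancel_one' by (metis comp_apply)
qed

section \<open>Isomorphism with a system of bidiagonal matrices\<close>

text \<open>The basis behind the split form gives the coordinate map \<open>\<sigma>\<close>;
  conjugating the idempotents by it yields those of the matrix system.\<close>

lemma CH_isomorphic_bidiag:
  fixes V :: "('a::field, 'v) module"
  assumes A: "endomorphism V A" and As: "endomorphism V As"
    and par: "CH_parameters d V (A, E, As, Es) \<theta> \<theta>s \<phi>" and P: "P \<theta> \<theta>s \<phi>"
  shows "\<exists>\<Psi> \<in> CH_family d P. CH_isomorphic d V (A, E, As, Es) (module_vec TYPE('a) (d + 1)) \<Psi>"
proof -
  let ?W = "module_vec TYPE('a) (d + 1)"
  let ?L = "lower_bidiag d \<theta>" and ?U = "upper_bidiag d \<theta>s \<phi>"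
  obtain v where v: "ordered_basis d V v" "represents d V v ?L A" "represents d V v ?U As"
    using par by auto
  note V = linear_mapD(1)[OF A]
  define \<tau> where "\<tau> = from_coords d V v"
  define \<sigma> where "\<sigma> = inv_into (carrier ?W) \<tau>"
  have lin\<tau>: "linear_map class_ring ?W V \<tau>" and bij\<tau>: "bij_betw \<tau> (carrier ?W) (carrier V)"
    using linear_map_from_coords[OF V v(1)] bij_from_coords[OF V v(1)] by (simp_all add: \<tau>_def)
  have lin\<sigma>: "linear_map class_ring V ?W \<sigma>" and bij\<sigma>: "bij_betw \<sigma> (carrier V) (carrier ?W)"
    unfolding \<sigma>_def using linear_map_inv_into[OF lin\<tau> bij\<tau>] bij_betw_inv_into[OF bij\<tau>] by simp_all
  have \<sigma>\<tau>: "\<sigma> (\<tau> x) = x" if "x \<in> carrier ?W" for x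
    unfolding \<sigma>_def using bij_betw_inv_into_left[OF bij\<tau> that] .
  have \<tau>\<sigma>: "\<tau> (\<sigma> y) = y" if "y \<in> carrier V" for y
    unfolding \<sigma>_def using bij_betw_inv_into_right[OF bij\<tau> that] .
  have intertwine: "intertwines V \<sigma> B ((*\<^sub>v) M)"
    if B: "endomorphism V B" "represents d V v M B" and M: "M \<in> carrier_mat (d + 1) (d + 1)" for B M
    unfolding intertwines_def
  proof
    fix y assume y: "y \<in> carrier V"
    then have x: "\<sigma> y \<in> carrier ?W" using lin\<sigma> by (rule linear_mapD(3)[rotated])
    then have "\<tau> (M *\<^sub>v \<sigma> y) = B y"
      unfolding \<tau>_def
      by (subst from_coords_mult_mat_vec[OF V v(1) B M]) (use \<tau>\<sigma>[OF y] in \<open>simp_all add: \<tau>_def module_vec_simps\<close>)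
    moreover have "M *\<^sub>v \<sigma> y \<in> carrier ?W" using x M by (simp add: module_vec_simps)
    ultimately show "\<sigma> (B y) = M *\<^sub>v \<sigma> y" using \<sigma>\<tau> by metis
  qed
  have transfer: "primitive_idempotent ?W B' t (\<sigma> \<circ> F \<circ> \<tau>)"
    if B: "intertwines V \<sigma> B B'" "endomorphism V B" and F: "primitive_idempotent V B t F" for B B' t F
  proof -
    \<comment> \<open>\<open>\<tau>\<close> carries eigenvectors of \<open>B'\<close> to
      eigenvectors of \<open>B\<close>, where the action of \<open>F\<close> is known.\<close>
    have eig: "\<tau> y \<in> eigen_space V B s" if "y \<in> eigen_space ?W B' s" for y s
    proof -
      have y: "y \<in> carrier ?W" "B' y = s \<odot>\<^bsub>?W\<^esub> y" using that by (simp_all add: eigen_space_def)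
      have \<tau>y: "\<tau> y \<in> carrier V" using lin\<tau> y(1) by (rule linear_mapD(3))
      then have "\<sigma> (B (\<tau> y)) = s \<odot>\<^bsub>?W\<^esub> y" using B(1) y \<sigma>\<tau> by (simp add: intertwines_def)
      then have "\<tau> (\<sigma> (B (\<tau> y))) = s \<odot>\<^bsub>V\<^esub> \<tau> y" using linear_mapD(5)[OF lin\<tau> y(1)] by simp
      then show ?thesis using \<tau>y \<tau>\<sigma> linear_mapD(3)[OF B(2) \<tau>y] by (simp add: eigen_space_def)
    qed
    have "endomorphism ?W (\<sigma> \<circ> F \<circ> \<tau>)"
      using F lin\<tau> lin\<sigma> by (auto simp: primitive_idempotent_def intro: linear_map_comp)
    moreover obtain w where w: "w \<in> carrier V" "B w = t \<odot>\<^bsub>V\<^esub> w" "w \<noteq> \<zero>\<^bsub>V\<^esub>"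
      using F unfolding primitive_idempotent_def eigen_value_def eigen_space_def by blast
    then have "\<sigma> w \<in> eigen_space ?W B' t"
      using B(1) linear_mapD(3,5)[OF lin\<sigma> w(1)] unfolding intertwines_def eigen_space_def by simp metis
    moreover have "\<sigma> w \<noteq> \<zero>\<^bsub>?W\<^esub>"
      using w \<tau>\<sigma>[OF w(1)] linear_map_zero[OF lin\<tau>] by metis
    moreover have "(\<sigma> \<circ> F \<circ> \<tau>) y = y" if "y \<in> eigen_space ?W B' t" for y
      using F eig[OF that] \<sigma>\<tau>[of y] that by (simp add: primitive_idempotent_def eigen_space_def)
    moreover have "(\<sigma> \<circ> F \<circ> \<tau>) y = \<zero>\<^bsub>?W\<^esub>" if "y \<in> eigen_space ?W B' s" "s \<noteq> t" for y s
      using F eig[OF that(1)] that(2) linear_map_zero[OF lin\<sigma>] by (simp add: primitive_idempotent_def)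
    ultimately show ?thesis
      unfolding primitive_idempotent_def eigen_value_def by blast
  qed
  have FE: "intertwines V \<sigma> F (\<sigma> \<circ> F \<circ> \<tau>)" for F
    using \<tau>\<sigma> by (simp add: intertwines_def)
  let ?\<Psi> = "((*\<^sub>v) ?L, \<lambda>i. \<sigma> \<circ> E i \<circ> \<tau>, (*\<^sub>v) ?U, \<lambda>i. \<sigma> \<circ> Es i \<circ> \<tau>)"
  note int = intertwine[OF A v(2) bidiag_carrier(1)] intertwine[OF As v(3) bidiag_carrier(2)]
  have idem: "\<forall>i\<le>d. primitive_idempotent ?W ((*\<^sub>v) ?L) (\<theta> i) (\<sigma> \<circ> E i \<circ> \<tau>) \<and>
      primitive_idempotent ?W ((*\<^sub>v) ?U) (\<theta>s i) (\<sigma> \<circ> Es i \<circ> \<tau>)"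
    using transfer[OF int(1) A] transfer[OF int(2) As] par by simp
  have "?\<Psi> \<in> CH_family d P"
    unfolding CH_family_def
    by (rule CollectI, rule exI[of _ \<theta>], rule exI[of _ \<theta>s], rule exI[of _ \<phi>],
        rule exI[of _ "\<lambda>i. \<sigma> \<circ> E i \<circ> \<tau>"], rule exI[of _ "\<lambda>i. \<sigma> \<circ> Es i \<circ> \<tau>"])
      (intro conjI refl P idem)
  moreover have "CH_isomorphic d V (A, E, As, Es) ?W ?\<Psi>"
    unfolding CH_isomorphic.simps using lin\<sigma> bij\<sigma> int FE by blast
  ultimately show ?thesis by blast
qed

section \<open>Classification of recurrent CH systems\<close>

theorem theorem5p6:
  fixes d :: nat
    and V :: "('a::field, 'v) module"
    and \<Phi> :: "'v map_system"
  assumes "d \<ge> 3"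
    and "CH_system d V \<Phi>"
    and "recurrent_CH d V \<Phi>"
  shows "\<exists>\<Psi> \<in> CH_family d (type_I d) \<union> CH_family d (type_II d)
               \<union> CH_family d (type_III d) \<union> CH_family d (type_IV d).
           CH_isomorphic d V \<Phi> (module_vec TYPE('a) (d + 1)) \<Psi>"
proof -
  obtain A E As Es where \<Phi>: "\<Phi> = (A, E, As, Es)" by (cases \<Phi>)
  obtain \<theta> \<theta>s \<phi> \<beta> where par: "CH_parameters d V (A, E, As, Es) \<theta> \<theta>s \<phi>"
    and rec: "beta_recurrent \<beta> d \<theta>" "beta_recurrent \<beta> d \<theta>s"
      "beta_recurrent \<beta> (d + 1) (vartheta d \<theta> \<theta>s \<phi>)"
    using assms(3) unfolding recurrent_CH_def \<Phi> by blast
  have sys: "CH_system d V (A, E, As, Es)" using assms(2) \<Phi> by simp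
  then have A: "endomorphism V A" and As: "endomorphism V As" "diagonalizable_map V As"
    by (simp_all add: multiplicity_free_def)
  obtain v where v: "ordered_basis d V v" "represents d V v (lower_bidiag d \<theta>) A"
    "represents d V v (upper_bidiag d \<theta>s \<phi>) As"
    using par by auto
  have inj: "inj_on \<theta> {0..d}" "inj_on \<theta>s {0..d}"
    using eigen_value_ordering_inj[of d V A E \<theta>] eigen_value_ordering_inj[of d V As Es \<theta>s] sys par
    by simp_all
  have \<phi>: "\<phi> i \<noteq> 0" if "i \<in> {1..d}" for i using par that by simp
  \<comment> \<open>Among indices up to \<open>d\<close>, the condition \<open>j = i + d\<close>
    holds only for \<open>i = 0\<close> and \<open>j = d\<close>.\<close>
  have corner: "\<not> zero_map V (Es 0 \<circ> A \<circ> Es d)"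
  proof -
    have "circular_hessenberg d V Es A" using sys by simp
    from this[unfolded circular_hessenberg_def, rule_format, of 0 d] show ?thesis by simp
  qed
  interpret recurrent_parameters d \<theta> \<theta>s \<phi> \<beta>
  proof
    fix r
    show "\<not> corner_sequence d \<theta>s (vartheta d \<theta> \<theta>s \<phi>) r"
    proof
      assume "corner_sequence d \<theta>s (vartheta d \<theta> \<theta>s \<phi>) r"
      moreover have "\<theta>s d \<noteq> \<theta>s 0" using inj(2) assms(1) by (auto dest: inj_onD)
      moreover have "primitive_idempotent V As (\<theta>s 0) (Es 0)" "primitive_idempotent V As (\<theta>s d) (Es d)"
        using par by simp_all
      ultimately show False
        using corner_sequence_imp_zero_map[OF A As _ _ _ v \<phi>] corner by blast
    qed
  qed (use assms(1) inj \<phi> rec in auto)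
  note iso = CH_isomorphic_bidiag[OF A As(1) par]
  from type_cases show ?thesis
    unfolding \<Phi> using iso[of "type_I d"] iso[of "type_II d"] iso[of "type_III d"] iso[of "type_IV d"]
    by blast
qed

end
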